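(* Let $M$ be a smooth second countable manifold of dimension $n$ and $(\mathcal M,G)$ the manifold of Riemannian metrics on $M$ with $G_g(h,k)=\int_M\operatorname{tr}(g^{-1}hg^{-1}k)\operatorname{vol}(g)$. Let $g(t)=g^0e^{a(t)\mathrm{Id}+b(t)H_0}$ be the geodesic starting at $g^0$ in direction $h\in T_{g^0}\mathcal M$. For $k,\ell\in T_{g^0}\mathcal M$ the Jacobi field $J(t)$ along $g(t)$ with $J(0)=k$ and $(\nabla_{\partial_t}J)(0)=\ell$ is $$\begin{aligned}J(t)&=\frac{\operatorname{tr}(H\hat L)}{\operatorname{tr}(H^2)}\,t\,g'(t)+\frac{\operatorname{tr}(\hat L)\operatorname{tr}(H^2)-\operatorname{tr}(\hat LH)\operatorname{tr}(H)}{\operatorname{tr}(H^2)}\,t\,(g'(t))^\perp+b(t)g(t)\Big(-\frac{\operatorname{tr}(H_0\hat L_0)}{\operatorname{tr}(H_0^2)}H_0+\hat L_0\Big)\\&\quad+g(t)\sum_{m=1}^\infty\frac{(-\operatorname{ad}(b(t)H))^m}{(m+1)!}\big(b(t)\hat L\big)+k(g^0)^{-1}g(t),\end{aligned}$$ where $H=(g^0)^{-1}h$, $K=(g^0)^{-1}k$, $L=(g^0)^{-1}\ell$, $\hat L=-KH+L+(g^0)^{-1}\Gamma_{g^0}(k,h)$, and $(g'(t))^\perp=g(t)P(t)^\perp$.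
   Context: $T\mathcal M=\mathcal M\times\mathcal D(S^2T^*M)$ with $\mathcal D$ the compactly supported symmetric 2-tensor fields viewed as maps $TM\to T^*M$. For an endomorphism field $A$, $A_0:=A-\frac{\operatorname{tr}A}n\mathrm{Id}$; $\operatorname{ad}(X)Y=XY-YX$. Christoffel symbol: $\Gamma_g(h,k)=\tfrac12hg^{-1}k+\tfrac12kg^{-1}h+\tfrac14\operatorname{tr}(g^{-1}hg^{-1}k)g-\tfrac14\operatorname{tr}(g^{-1}h)k-\tfrac14\operatorname{tr}(g^{-1}k)h$, $\nabla_{\partial_t}\xi=\xi_t-\Gamma_g(g_t,\xi)$. Jacobi fields along a geodesic are infinitesimal geodesic variations $\partial_s|_0\alpha(t,s)$. The functions in the geodesic are $a(t)=\tfrac2n\log\big((1+\tfrac t4\operatorname{tr}H)^2+\tfrac n{16}\operatorname{tr}(H_0^2)t^2\big)$ and $b(t)=\frac4{\sqrt{n\operatorname{tr}(H_0^2)}}\operatorname{arctg}\big(\frac{\sqrt{n\operatorname{tr}(H_0^2)}t}{4+t\operatorname{tr}H}\big)$ where $\operatorname{tr}(H_0^2)\ne0$ (arctg in $(-\frac\pi2,\frac\pi2)$ where $\operatorname{tr}H\ge0$; where $\operatorname{tr}H<0$ taken in $[0,\frac\pi2)$ for $t<-4/\operatorname{tr}H$, $=\frac\pi2$ at $t=-4/\operatorname{tr}H$, in $(\frac\pi2,\pi)$ after), and $b(t)=\frac t{1+\frac t4\operatorname{tr}H}$ where $\operatorname{tr}(H_0^2)=0$. Let $P(t):=g(t)^{-1}g'(t)=e^{-\frac12na(t)}\big(\frac{4\operatorname{tr}(H)+nt\operatorname{tr}(H^2)}{4n}\mathrm{Id}+H_0\big)$,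 and let $P(t)^\perp$ be the $\binom11$-tensor field which at each point lies in the plane spanned by $\mathrm{Id}$ and $H_0$, has trace $e^{-\frac12na(t)}$, and is orthogonal to $P(t)$ with respect to the inner product $(A,B)\mapsto\operatorname{tr}(AB)$.
   Formalization: Proved at each point of M (tensors as matrices in a frame) where h is nonzero; where h vanishes the coefficients over tr(H²) are 0/0. Where H₀=0 but H≠0, the 0/0 and P^⊥ terms count as zero. For t<0, b is the continuous arctg branch. *)

theory Defs
  imports "HOL-Analysis.Analysis"
begin

text \<open>Pointwise setting: all tensor fields are evaluated at a fixed point of M in a
  fixed coordinate frame, so they become real n x n matrices (n = CARD('n)).
  Symmetric 2-tensors (maps TM to T*M) and (1,1)-tensors (endomorphisms) are both matrices.\<close>

type_synonym 'n mat = "real^'n^'n"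

definition sym_mat :: "'n::finite mat \<Rightarrow> bool" where
  "sym_mat A \<longleftrightarrow> transpose A = A"

definition posdef_sym :: "'n::finite mat \<Rightarrow> bool" where
  "posdef_sym A \<longleftrightarrow> sym_mat A \<and> (\<forall>x. x \<noteq> 0 \<longrightarrow> 0 < x \<bullet> (A *v x))"

definition tf :: "'n::finite mat \<Rightarrow> 'n mat" where
  "tf A = A - (trace A / real CARD('n)) *\<^sub>R mat 1"

definition ad :: "'n::finite mat \<Rightarrow> 'n mat \<Rightarrow> 'n mat" where
  "ad X Y = X ** Y - Y ** X"

primrec mpow :: "'n::finite mat \<Rightarrow> nat \<Rightarrow> 'n mat" where
  "mpow A 0 = mat 1"
| "mpow A (Suc m) = A ** mpow A m"

definition mexp :: "'n::finite mat \<Rightarrow> 'n mat" where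
  "mexp A = (\<Sum>m. (1 / fact m) *\<^sub>R mpow A m)"

definition Christ :: "'n::finite mat \<Rightarrow> 'n mat \<Rightarrow> 'n mat \<Rightarrow> 'n mat" where
  "Christ g h k =
     (1/2) *\<^sub>R (h ** matrix_inv g ** k) + (1/2) *\<^sub>R (k ** matrix_inv g ** h)
   + (1/4 * trace (matrix_inv g ** h ** matrix_inv g ** k)) *\<^sub>R g
   - (1/4 * trace (matrix_inv g ** h)) *\<^sub>R k - (1/4 * trace (matrix_inv g ** k)) *\<^sub>R h"

definition is_geodesic :: "(real \<Rightarrow> 'n::finite mat) \<Rightarrow> real set \<Rightarrow> bool" where
  "is_geodesic c I \<longleftrightarrow> (\<exists>c' c''. \<forall>t\<in>I.
      posdef_sym (c t) \<and> (c has_vector_derivative c' t) (at t)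
      \<and> (c' has_vector_derivative c'' t) (at t) \<and> c'' t = Christ (c t) (c' t) (c' t))"

definition C2_on :: "('a::real_normed_vector \<Rightarrow> 'b::real_normed_vector) \<Rightarrow> 'a set \<Rightarrow> bool" where
  "C2_on f S \<longleftrightarrow> (\<exists>(f' :: 'a \<Rightarrow> 'a \<Rightarrow>\<^sub>L 'b) (f'' :: 'a \<Rightarrow> 'a \<Rightarrow>\<^sub>L ('a \<Rightarrow>\<^sub>L 'b)).
      (\<forall>x\<in>S. (f has_derivative blinfun_apply (f' x)) (at x))
    \<and> (\<forall>x\<in>S. (f' has_derivative blinfun_apply (f'' x)) (at x))
    \<and> continuous_on S f'')"

text \<open>The functions a(t), b(t) of the geodesic, for H = g0^{-1} h.  For tr(H_0^2) <> 0 the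
  arctangent is taken on the continuous branch with b(0)=0 (this is the paper's branch
  convention; for t >= 0 it is literally the paper's description).\<close>
definition geo_a :: "'n::finite mat \<Rightarrow> real \<Rightarrow> real" where
  "geo_a H t = (2 / real CARD('n)) *
     ln ((1 + t/4 * trace H)\<^sup>2 + real CARD('n) / 16 * trace (tf H ** tf H) * t\<^sup>2)"

definition geo_b :: "'n::finite mat \<Rightarrow> real \<Rightarrow> real" where
  "geo_b H t =
    (if trace (tf H ** tf H) \<noteq> 0 then
       (let s = sqrt (real CARD('n) * trace (tf H ** tf H)); d = 4 + t * trace H;
            th = (if d > 0 then arctan (s * t / d)
                  else if d = 0 then sgn t * (pi/2)
                  else arctan (s * t / d) + sgn t * pi)
        in 4 / s * th)
     else t / (1 + t/4 * trace H))"

definition geo :: "'n::finite mat \<Rightarrow> 'n mat \<Rightarrow> real \<Rightarrow> 'n mat" where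
  "geo g0 h t = (let H = matrix_inv g0 ** h in
      g0 ** mexp (geo_a H t *\<^sub>R mat 1 + geo_b H t *\<^sub>R tf H))"

text \<open>P(t) = g(t)^{-1} g'(t), in the explicit form given in the paper.\<close>
definition Pgeo :: "'n::finite mat \<Rightarrow> real \<Rightarrow> 'n mat" where
  "Pgeo H t = exp (- real CARD('n) / 2 * geo_a H t) *\<^sub>R
     (((4 * trace H + real CARD('n) * t * trace (H ** H)) / (4 * real CARD('n))) *\<^sub>R mat 1 + tf H)"

definition Pperp :: "'n::finite mat \<Rightarrow> real \<Rightarrow> 'n mat" where
  "Pperp H t = (THE X. (\<exists>\<alpha> \<beta>. X = \<alpha> *\<^sub>R mat 1 + \<beta> *\<^sub>R tf H)
      \<and> trace X = exp (- real CARD('n) / 2 * geo_a H t)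
      \<and> trace (Pgeo H t ** X) = 0)"

end

theory Submission
  imports Defs
begin

text \<open>With P = g^{-1} g' the geodesic equation becomes the system g' = g P,
  P' = tr(PP)/4 Id - tr(P)/2 P.  Differentiating it with respect to the variation parameter s,
  J = dg/ds and Q = dP/ds satisfy the linear system
  J' = J P + g Q,  Q' = tr(PQ)/2 Id - tr(Q)/2 P - tr(P)/2 Q,  J(0) = k,  Q(0) = Lh,
  so it suffices to exhibit a solution.  In the plane spanned by Id and H_0 the equation for Q
  is solved by the derivatives of t P and t P^perp, and the component of Q orthogonal to this plane
  is a constant matrix V times b' = 1/D, where D = exp(n a/2).  Writing J = g Y + k g0^{-1} g, the first
  equation becomes Y' = - ad(P) Y + Q, whose part transverse to the plane integrates to the
  series for (1 - exp(-b ad H)) / ad H applied to V.\<close>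

section \<open>Matrix algebra and positive definite forms\<close>

text \<open>The gain from P is that its equation no longer contains g: the linearised system is
  triangular, so Q is found first and J follows. The obstacle is regularity. The variation is only
  C2, so smoothness gives no t-derivative of dP/ds. The geodesic equation has to supply dP/dt as a
  polynomial in P, whose s-derivative exists, and the partial derivatives are then interchanged by
  integrating in t. The plane of Id and H_0 enters because P stays in it. Rescaling the initial
  velocity replaces P(t) by c P(c t), whose derivative at c = 1 is (t P)'; t P^perp provides the
  second solution inside the plane. Everything in the plane commutes with P, hence only V feeds the
  ad-series. A Gronwall estimate identifies the solutions, once for Q and once for J. When H_0 = 0
  the plane collapses to a line; the formula survives because the coefficient of P^perp vanishes, as
  does the H_0 multiplied by the quotient with denominator tr(H_0^2).\<close>

lemma bounded_bilinear_matrix_mult: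
  "bounded_bilinear ((**) :: real^'n::finite^'n \<Rightarrow> real^'n^'n \<Rightarrow> real^'n^'n)"
proof -
  have "bilinear ((**) :: real^'n^'n \<Rightarrow> real^'n^'n \<Rightarrow> real^'n^'n)"
    unfolding bilinear_def linear_iff
    by (auto simp: vec_eq_iff matrix_matrix_mult_def sum.distrib algebra_simps sum_distrib_left)
  then show ?thesis by (simp add: bilinear_conv_bounded_bilinear)
qed

lemmas matrix_mult_algebra =
  bounded_bilinear.add_left[OF bounded_bilinear_matrix_mult]
  bounded_bilinear.add_right[OF bounded_bilinear_matrix_mult]
  bounded_bilinear.diff_left[OF bounded_bilinear_matrix_mult]
  bounded_bilinear.diff_right[OF bounded_bilinear_matrix_mult]
  bounded_bilinear.minus_left[OF bounded_bilinear_matrix_mult]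
  bounded_bilinear.minus_right[OF bounded_bilinear_matrix_mult]
  bounded_bilinear.zero_left[OF bounded_bilinear_matrix_mult]
  bounded_bilinear.zero_right[OF bounded_bilinear_matrix_mult]
  bounded_bilinear.scaleR_left[OF bounded_bilinear_matrix_mult]
  bounded_bilinear.scaleR_right[OF bounded_bilinear_matrix_mult]

lemmas has_vector_derivative_matrix_mult =
  bounded_bilinear.has_vector_derivative[OF bounded_bilinear_matrix_mult]

lemmas continuous_on_matrix_mult =
  bounded_bilinear.continuous_on[OF bounded_bilinear_matrix_mult]

lemma bounded_linear_trace: "bounded_linear (trace :: real^'n::finite^'n \<Rightarrow> real)"
  by (simp add: linear_conv_bounded_linear[symmetric] linear_iff trace_def sum.distrib sum_distrib_left)

lemmas trace_algebra =
  bounded_linear.linear[OF bounded_linear_trace, THEN linear_add]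
  bounded_linear.linear[OF bounded_linear_trace, THEN linear_diff]
  bounded_linear.linear[OF bounded_linear_trace, THEN linear_scale]
  bounded_linear.linear[OF bounded_linear_trace, THEN linear_neg]
  bounded_linear.linear[OF bounded_linear_trace, THEN linear_0]

lemma matrix_inv_left_right:
  assumes "invertible A"
  shows "matrix_inv A ** A = mat 1" "A ** matrix_inv A = mat 1"
proof -
  from assms obtain B where "A ** B = mat 1 \<and> B ** A = mat 1"
    by (auto simp: invertible_def)
  then have "A ** matrix_inv A = mat 1 \<and> matrix_inv A ** A = mat 1"
    unfolding matrix_inv_def by (rule someI)
  then show "matrix_inv A ** A = mat 1" "A ** matrix_inv A = mat 1" by auto
qed

lemma posdef_sym_invertible:
  assumes "posdef_sym g"
  shows "invertible g"
proof -
  have "x = 0" if "g *v x = 0" for x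
    using assms that unfolding posdef_sym_def by (metis inner_zero_right less_irrefl)
  then show ?thesis
    by (simp add: invertible_left_inverse matrix_left_invertible_ker)
qed

text \<open>Gram-Schmidt for the inner product \<open>x \<bullet> (g *v y)\<close>. Induction over
  sets of indices keeps the count available: a missing index forces fewer than n vectors so far,
  hence a vector outside their span.\<close>

lemma posdef_sym_orthonormal_family:
  fixes g :: "real^'n::finite^'n"
  assumes g: "posdef_sym g"
  shows "\<exists>f::'n \<Rightarrow> real^'n. \<forall>i\<in>A. \<forall>j\<in>A. f i \<bullet> (g *v f j) = (if i = j then 1 else 0)"
proof (induction A rule: finite_induct[OF finite])
  case 1
  then show ?case by simp
next
  case (2 a F)
  then obtain f :: "'n \<Rightarrow> real^'n"
    where f: "\<forall>i\<in>F. \<forall>j\<in>F. f i \<bullet> (g *v f j) = (if i = j then 1 else 0)" by blast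
  have sym: "x \<bullet> (g *v y) = y \<bullet> (g *v x)" for x y
    using g unfolding posdef_sym_def sym_mat_def
    by (metis dot_lmul_matrix inner_commute vector_transpose_matrix)
  have "dim (f ` F) \<le> card (f ` F)" by (simp add: dim_le_card')
  also have "\<dots> \<le> card F" by (simp add: card_image_le)
  also have "\<dots> < CARD('n)" using 2 by (metis UNIV_I finite psubset_card_mono subsetI psubsetI)
  finally have "dim (span (f ` F)) \<noteq> DIM(real^'n)" by simp
  then have "span (f ` F) \<noteq> UNIV" by (metis dim_UNIV)
  then obtain v where v: "v \<notin> span (f ` F)" by blast
  define w where "w = v - (\<Sum>i\<in>F. (f i \<bullet> (g *v v)) *\<^sub>R f i)"
  have "w \<noteq> 0"
  proof
    assume "w = 0"
    then have "v = (\<Sum>i\<in>F. (f i \<bullet> (g *v v)) *\<^sub>R f i)" by (simp add: w_def)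
    also have "\<dots> \<in> span (f ` F)" by (intro span_sum span_scale span_base) auto
    finally show False using v by simp
  qed
  then have pos: "0 < w \<bullet> (g *v w)" using g by (simp add: posdef_sym_def)
  have orth: "f j \<bullet> (g *v w) = 0" if "j \<in> F" for j
  proof -
    have "f j \<bullet> (g *v w) = w \<bullet> (g *v f j)" by (rule sym)
    also have "\<dots> = v \<bullet> (g *v f j) - (\<Sum>i\<in>F. (f i \<bullet> (g *v v)) * (f i \<bullet> (g *v f j)))"
      by (simp add: w_def inner_diff_left inner_sum_left)
    also have "(\<Sum>i\<in>F. (f i \<bullet> (g *v v)) * (f i \<bullet> (g *v f j))) = (\<Sum>i\<in>F. if i = j then f i \<bullet> (g *v v) else 0)"
      using f that by (intro sum.cong) auto
    also have "\<dots> = f j \<bullet> (g *v v)" using that by simp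
    finally show ?thesis using sym[of v "f j"] by simp
  qed
  define u where "u = (1 / sqrt (w \<bullet> (g *v w))) *\<^sub>R w"
  have uu: "u \<bullet> (g *v u) = 1"
    using pos by (simp add: u_def matrix_vector_mult_scaleR)
  have uo: "f j \<bullet> (g *v u) = 0" "u \<bullet> (g *v f j) = 0" if "j \<in> F" for j
    using orth[OF that] sym[of u "f j"] by (simp_all add: u_def matrix_vector_mult_scaleR)
  show ?case
    by (rule exI[of _ "f(a := u)"]) (use 2 f uu uo in auto)
qed

text \<open>The columns of \<open>E\<close> are the orthonormal family, and
  \<open>E ** transpose E\<close> is then the inverse of \<open>g\<close>: a substitute for a square
  root of \<open>matrix_inv g\<close>.\<close>

lemma posdef_sym_congruent_identity:
  fixes g :: "real^'n::finite^'n"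
  assumes "posdef_sym g"
  obtains E :: "real^'n^'n" where "transpose E ** g ** E = mat 1"
proof -
  obtain f :: "'n \<Rightarrow> real^'n"
    where f: "\<forall>i j. f i \<bullet> (g *v f j) = (if i = j then 1 else 0)"
    using posdef_sym_orthonormal_family[OF assms, of UNIV] by auto
  define E :: "real^'n^'n" where "E = (\<chi> i j. f j $ i)"
  have "(transpose E ** (g ** E)) $ i $ j = f i \<bullet> (g *v f j)" for i j
    by (simp add: E_def transpose_def matrix_matrix_mult_def inner_vec_def matrix_vector_mult_def)
  then have "transpose E ** g ** E = mat 1"
    using f by (simp add: vec_eq_iff mat_def matrix_mul_assoc[symmetric])
  then show ?thesis by (rule that)
qed

text \<open>In a g-orthonormal frame E, the endomorphism matrix_inv g ** h becomes the symmetric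
  matrix transpose E ** h ** E.\<close>
lemma trace_square_selfadjoint:
  fixes g h :: "real^'n::finite^'n"
  assumes g: "posdef_sym g" and h: "sym_mat h"
  defines "A \<equiv> matrix_inv g ** h"
  shows "0 \<le> trace (A ** A)" and "trace (A ** A) = 0 \<Longrightarrow> A = 0"
proof -
  obtain E :: "real^'n^'n" where E: "transpose E ** g ** E = mat 1"
    using posdef_sym_congruent_identity[OF g] .
  have E1: "E ** (transpose E ** g) = mat 1" using E by (simp add: matrix_left_right_inverse)
  note inv = matrix_inv_left_right[OF posdef_sym_invertible[OF g]]
  have EE: "E ** transpose E = matrix_inv g"
    using E1 inv by (metis matrix_mul_assoc matrix_mul_lid matrix_mul_rid)
  define B where "B = transpose E ** h ** E"
  have A: "A = E ** (transpose E ** h)" by (simp add: A_def EE matrix_mul_assoc)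
  have "trace (A ** A) = trace (E ** (transpose E ** h ** E ** (transpose E ** h)))"
    by (simp add: A matrix_mul_assoc)
  also have "\<dots> = trace (transpose E ** h ** E ** (transpose E ** h) ** E)"
    by (rule trace_mul_sym)
  also have "\<dots> = trace (B ** B)"
    by (simp add: B_def matrix_mul_assoc)
  also have "transpose B = B"
    using h by (simp add: B_def matrix_transpose_mul transpose_transpose sym_mat_def matrix_mul_assoc)
  then have "B $ i $ j = B $ j $ i" for i j
    by (metis (no_types, lifting) transpose_def vec_lambda_beta)
  then have "trace (B ** B) = (\<Sum>i\<in>UNIV. \<Sum>j\<in>UNIV. (B $ i $ j)\<^sup>2)"
    by (simp add: trace_def matrix_matrix_mult_def power2_eq_square)
  finally have tr: "trace (A ** A) = (\<Sum>i\<in>UNIV. \<Sum>j\<in>UNIV. (B $ i $ j)\<^sup>2)" .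
  show "0 \<le> trace (A ** A)" unfolding tr by (intro sum_nonneg) auto
  assume "trace (A ** A) = 0"
  then have "B = 0"
    unfolding tr by (simp add: sum_nonneg_eq_0_iff sum_nonneg vec_eq_iff)
  moreover have "A = E ** B ** (transpose E ** g)"
  proof -
    have "E ** B ** (transpose E ** g) = E ** transpose E ** h ** (E ** (transpose E ** g))"
      by (simp add: B_def matrix_mul_assoc)
    then show ?thesis unfolding E1 by (simp add: A matrix_mul_assoc)
  qed
  ultimately show "A = 0" by (simp add: matrix_mult_algebra)
qed

section \<open>Differentiating the matrix inverse\<close>

lemma continuous_on_det [continuous_intros]:
  fixes f :: "'a::topological_space \<Rightarrow> real^'n::finite^'n"
  assumes "\<And>i j. continuous_on S (\<lambda>x. f x $ i $ j)"
  shows "continuous_on S (\<lambda>x. det (f x))"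
  unfolding det_def by (intro continuous_on_sum continuous_on_mult continuous_on_const continuous_on_prod assms)

text \<open>Cramer's rule for the right-hand side \<open>axis l 1\<close>. It makes the entries of
  the inverse quotients of determinants, from which continuity can be read off.\<close>

lemma matrix_inv_cramer:
  fixes A :: "real^'n::finite^'n"
  assumes "invertible A"
  shows "matrix_inv A $ k $ l = det (\<chi> i j. if j = k then axis l 1 $ i else A $ i $ j) / det A"
proof -
  have "A *v (matrix_inv A *v axis l 1) = axis l 1"
    by (simp add: matrix_vector_mul_assoc matrix_inv_left_right[OF assms])
  then have "matrix_inv A *v axis l 1
     = (\<chi> k. det (\<chi> i j. if j = k then axis l 1 $ i else A $ i $ j) / det A)"
    using assms by (subst (asm) cramer) (auto simp: invertible_det_nz)
  then have "(matrix_inv A *v axis l 1) $ k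
     = det (\<chi> i j. if j = k then axis l 1 $ i else A $ i $ j) / det A" by simp
  then show ?thesis
    by (simp add: matrix_vector_mult_basis column_def)
qed

lemma open_invertible: "open {A :: real^'n::finite^'n. invertible A}"
proof -
  have "open ((det :: real^'n^'n \<Rightarrow> real) -` (- {0}))"
    by (intro open_vimage continuous_on_det continuous_intros open_Compl)
  also have "(det :: real^'n^'n \<Rightarrow> real) -` (- {0}) = {A. invertible A}"
    by (auto simp: invertible_det_nz)
  finally show ?thesis .
qed

lemma continuous_on_matrix_inv: "continuous_on {A. invertible A} (matrix_inv :: real^'n::finite^'n \<Rightarrow> _)"
proof -
  have "continuous_on {A. invertible A} (\<lambda>A :: real^'n^'n. \<chi> k l.
     det (\<chi> i j. if j = k then axis l 1 $ i else A $ i $ j) / det A)"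
  proof (intro continuous_on_vec_lambda continuous_on_divide continuous_on_det)
    fix i j k l
    show "continuous_on {A. invertible A}
       (\<lambda>x::real^'n^'n. (\<chi> i j. if j = k then axis l 1 $ i else x $ i $ j) $ i $ j)"
      by (cases "j = k") (auto intro!: continuous_intros)
  qed (auto intro!: continuous_intros simp: invertible_det_nz)
  then show ?thesis
    by (rule continuous_on_eq) (simp add: vec_eq_iff matrix_inv_cramer)
qed

text \<open>Continuity of inversion is enough: the remainder equals (A^-1 - B^-1) (B - A) A^-1, a
  factor tending to 0 times one of first order in B - A.\<close>

lemma has_derivative_matrix_inv:
  fixes A :: "real^'n::finite^'n"
  assumes A: "invertible A"
  shows "(matrix_inv has_derivative (\<lambda>X. - (matrix_inv A ** X ** matrix_inv A))) (at A)"
proof -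
  interpret mm: bounded_bilinear "(**) :: real^'n^'n \<Rightarrow> real^'n^'n \<Rightarrow> real^'n^'n"
    by (rule bounded_bilinear_matrix_mult)
  obtain C where C: "\<And>(X :: real^'n^'n) (Y :: real^'n^'n). norm (X ** Y) \<le> norm X * norm Y * C" "0 < C"
    using mm.pos_bounded by metis
  have isC: "isCont matrix_inv A"
    by (rule continuous_on_interior[OF continuous_on_matrix_inv]) (simp add: interior_open open_invertible A)
  have "bounded_linear (\<lambda>X. - (matrix_inv A ** X ** matrix_inv A))"
    by (intro bounded_linear_minus bounded_linear_compose[OF mm.bounded_linear_left mm.bounded_linear_right])
  moreover have "((\<lambda>B. (matrix_inv B - matrix_inv A - - (matrix_inv A ** (B - A) ** matrix_inv A)) /\<^sub>R norm (B - A))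
      \<longlongrightarrow> 0) (at A)"
  proof (rule Lim_null_comparison)
    have "((\<lambda>B. norm (matrix_inv A - matrix_inv B) * (norm (matrix_inv A) * C * C)) \<longlongrightarrow>
        norm (matrix_inv A - matrix_inv A) * (norm (matrix_inv A) * C * C)) (at A)"
      by (intro tendsto_intros isC[unfolded isCont_def])
    then show "((\<lambda>B. norm (matrix_inv A - matrix_inv B) * (norm (matrix_inv A) * C * C)) \<longlongrightarrow> 0) (at A)"
      by simp
    have "\<forall>\<^sub>F B in at A. invertible B"
      using open_invertible A by (auto simp: eventually_at_topological)
    then show "\<forall>\<^sub>F B in at A. norm ((matrix_inv B - matrix_inv A - - (matrix_inv A ** (B - A) ** matrix_inv A)) /\<^sub>R norm (B - A))
       \<le> norm (matrix_inv A - matrix_inv B) * (norm (matrix_inv A) * C * C)"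
      using eventually_neq_at_within[of A]
    proof eventually_elim
      case (elim B)
      note iA = matrix_inv_left_right[OF A] and iB = matrix_inv_left_right[OF elim(1)]
      have "(matrix_inv A - matrix_inv B) ** ((B - A) ** matrix_inv A)
        = matrix_inv B - matrix_inv A - - (matrix_inv A ** (B - A) ** matrix_inv A)"
        using iA iB by (simp add: matrix_mult_algebra matrix_mul_assoc)
      then have "norm (matrix_inv B - matrix_inv A - - (matrix_inv A ** (B - A) ** matrix_inv A))
        \<le> norm (matrix_inv A - matrix_inv B) * norm ((B - A) ** matrix_inv A) * C"
        by (metis C(1))
      also have "\<dots> \<le> norm (matrix_inv A - matrix_inv B) * (norm (B - A) * norm (matrix_inv A) * C) * C"
        using C by (intro mult_right_mono mult_left_mono) auto
      finally have "norm (matrix_inv B - matrix_inv A - - (matrix_inv A ** (B - A) ** matrix_inv A)) / norm (B - A)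
        \<le> norm (matrix_inv A - matrix_inv B) * (norm (matrix_inv A) * C * C)"
        using elim by (simp add: pos_divide_le_eq mult_ac)
      then show ?case by (simp add: divide_inverse mult.commute)
    qed
  qed
  ultimately show ?thesis by (simp add: has_derivative_at_within has_derivative_within)
qed

lemma has_vector_derivative_matrix_inv:
  fixes B :: "real \<Rightarrow> real^'n::finite^'n"
  assumes "invertible (B s)" "(B has_vector_derivative B') (at s)"
  shows "((\<lambda>x. matrix_inv (B x)) has_vector_derivative - (matrix_inv (B s) ** B' ** matrix_inv (B s))) (at s)"
  using has_derivative_compose[OF assms(2)[unfolded has_vector_derivative_def] has_derivative_matrix_inv[OF assms(1)]]
  by (simp add: has_vector_derivative_def matrix_mult_algebra)

section \<open>Exponential series, linear ODEs, interchange of partial derivatives\<close>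

text \<open>The coefficients are arbitrary up to geometric growth, so that the matrix exponential
  and the ad-series are both instances. Components reduce the claim to real power series; the
  factorials turn differentiation into a shift of the coefficients.\<close>

lemma exponential_series:
  fixes c :: "nat \<Rightarrow> 'a::euclidean_space"
  assumes c: "\<And>m. norm (c m) \<le> M * C ^ m"
  shows summable_exponential_series: "summable (\<lambda>m. (x ^ m / fact m) *\<^sub>R c m)"
    and has_vector_derivative_exponential_series:
      "((\<lambda>x. \<Sum>m. (x ^ m / fact m) *\<^sub>R c m) has_vector_derivative (\<Sum>m. (x ^ m / fact m) *\<^sub>R c (Suc m))) (at x)"
proof -
  have summ: "summable (\<lambda>m. (y ^ m / fact m) *\<^sub>R c' m)" if c': "\<And>m. norm (c' m) \<le> M' * C ^ m"
    for y M' and c' :: "nat \<Rightarrow> 'a"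
  proof (rule summable_comparison_test')
    show "summable (\<lambda>m. M' * (inverse (fact m) * (\<bar>y\<bar> * C) ^ m))"
      by (intro summable_mult summable_exp)
    show "norm ((y ^ m / fact m) *\<^sub>R c' m) \<le> M' * (inverse (fact m) * (\<bar>y\<bar> * C) ^ m)" for m
      using mult_left_mono[OF c'[of m], of "\<bar>y\<bar> ^ m / fact m"]
      by (simp add: power_mult_distrib power_abs field_simps)
  qed
  show "summable (\<lambda>m. (x ^ m / fact m) *\<^sub>R c m)" by (rule summ[OF c])
  have c': "norm (c (Suc m)) \<le> (M * C) * C ^ m" for m
    using c[of "Suc m"] by (simp add: mult.assoc)
  show "((\<lambda>x. \<Sum>m. (x ^ m / fact m) *\<^sub>R c m) has_vector_derivative (\<Sum>m. (x ^ m / fact m) *\<^sub>R c (Suc m))) (at x)"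
    unfolding has_vector_derivative_def
  proof (subst has_derivative_componentwise_within, intro ballI)
    fix i :: 'a assume "i \<in> Basis"
    note inner_suminf = bounded_linear.suminf[OF bounded_linear_inner_left[of i]]
    define a where "a m = (c m \<bullet> i) / fact m" for m
    have "summable (\<lambda>m. a m * y ^ m)" for y
      using bounded_linear.summable[OF bounded_linear_inner_left[of i] summ[OF c, of y]]
      by (simp add: a_def mult.commute)
    then have "((\<lambda>x. \<Sum>m. a m * x ^ m) has_field_derivative (\<Sum>m. diffs a m * x ^ m)) (at x)"
      by (rule termdiffs_strong_converges_everywhere)
    moreover have "(\<Sum>m. a m * y ^ m) = (\<Sum>m. (y ^ m / fact m) *\<^sub>R c m) \<bullet> i" for y
      by (subst inner_suminf[OF summ[OF c, of y]]) (simp add: a_def mult.commute)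
    moreover have "diffs a m * x ^ m = (x ^ m / fact m) *\<^sub>R c (Suc m) \<bullet> i" for m
      unfolding diffs_def a_def by (simp add: fact_reduce divide_simps del: of_nat_Suc)
    then have "(\<Sum>m. diffs a m * x ^ m) = (\<Sum>m. (x ^ m / fact m) *\<^sub>R c (Suc m)) \<bullet> i"
      by (subst inner_suminf[OF summ[OF c', of x]]) simp
    ultimately show "((\<lambda>x. (\<Sum>m. (x ^ m / fact m) *\<^sub>R c m) \<bullet> i) has_derivative
        (\<lambda>h. (h *\<^sub>R (\<Sum>m. (x ^ m / fact m) *\<^sub>R c (Suc m))) \<bullet> i)) (at x)"
      by (simp add: has_field_derivative_def mult.commute[of _ "(_::real)"] mult_commute_abs)
  qed
qed

text \<open>Gronwall's argument: between t0 and t the function c is at most some M, so exp(-2 M x)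
  |y|^2 is nonincreasing and exp(2 M x) |y|^2 is nondecreasing. The first settles t \<ge> t0, the
  second t < t0.\<close>

lemma linear_ode_unique_zero:
  fixes y :: "real \<Rightarrow> 'a::real_inner"
  assumes I: "is_interval I" "t0 \<in> I" "t \<in> I"
    and y: "\<And>t. t \<in> I \<Longrightarrow> (y has_vector_derivative y' t) (at t)"
    and bound: "\<And>t. t \<in> I \<Longrightarrow> norm (y' t) \<le> c t * norm (y t)"
    and c: "continuous_on I c"
    and y0: "y t0 = 0"
  shows "y t = 0"
proof -
  define a b where "a = min t0 t" and "b = max t0 t"
  have sub: "{a..b} \<subseteq> I"
  proof
    fix x assume "x \<in> {a..b}"
    then show "x \<in> I" using mem_is_interval_1_I[OF I(1)] I(2,3) unfolding a_def b_def
      by (metis atLeastAtMost_iff max_def min_def)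
  qed
  obtain M where M: "\<And>x. x \<in> {a..b} \<Longrightarrow> c x \<le> M"
    using continuous_attains_sup[of "{a..b}" c] continuous_on_subset[OF c sub]
    by (force simp: a_def b_def)
  have bd: "\<bar>2 * (y x \<bullet> y' x)\<bar> \<le> 2 * M * (y x \<bullet> y x)" if "x \<in> {a..b}" for x
  proof -
    have "\<bar>y x \<bullet> y' x\<bar> \<le> norm (y x) * norm (y' x)" by (rule Cauchy_Schwarz_ineq2)
    also have "\<dots> \<le> norm (y x) * (M * norm (y x))"
      using bound[of x] mult_right_mono[OF M[OF that], of "norm (y x)"] that sub
      by (intro mult_left_mono) force+
    finally have "\<bar>y x \<bullet> y' x\<bar> \<le> M * (y x \<bullet> y x)"
      by (simp add: power2_norm_eq_inner[symmetric] power2_eq_square mult_ac)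
    then show ?thesis by (simp add: abs_mult)
  qed
  \<comment> \<open>The factor s, taken as -1 or 1, serves both directions of time.\<close>
  have der: "((\<lambda>x. exp (s * (2 * M) * x) * (y x \<bullet> y x)) has_real_derivative
      exp (s * (2 * M) * x) * (s * (2 * M) * (y x \<bullet> y x) + 2 * (y x \<bullet> y' x))) (at x)"
    if "x \<in> {a..b}" for x s
  proof -
    have "((\<lambda>x. y x \<bullet> y x) has_vector_derivative (y x \<bullet> y' x + y' x \<bullet> y x)) (at x)"
      using bounded_bilinear.has_vector_derivative[OF bounded_bilinear_inner y y] that sub by blast
    then have "((\<lambda>x. y x \<bullet> y x) has_real_derivative (2 * (y x \<bullet> y' x))) (at x)"
      by (simp add: has_real_derivative_iff_has_vector_derivative inner_commute)
    note [derivative_intros] = this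
    show ?thesis by (auto simp: algebra_simps intro!: derivative_eq_intros)
  qed
  have "y t \<bullet> y t \<le> 0"
  proof (cases "t0 \<le> t")
    case True
    have "exp (-1 * (2 * M) * t) * (y t \<bullet> y t) \<le> exp (-1 * (2 * M) * t0) * (y t0 \<bullet> y t0)"
    proof (rule DERIV_nonpos_imp_nonincreasing[OF True])
      fix x assume "t0 \<le> x" "x \<le> t"
      then have x: "x \<in> {a..b}" by (auto simp: a_def b_def)
      show "\<exists>d. ((\<lambda>x. exp (-1 * (2 * M) * x) * (y x \<bullet> y x)) has_real_derivative d) (at x) \<and> d \<le> 0"
        by (rule exI, rule conjI, rule der[OF x, of "-1"], rule mult_nonneg_nonpos) (use bd[OF x] in auto)
    qed
    then show ?thesis using y0 by (simp add: mult_le_0_iff)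
  next
    case False
    then have le: "t \<le> t0" by simp
    have "exp (1 * (2 * M) * t) * (y t \<bullet> y t) \<le> exp (1 * (2 * M) * t0) * (y t0 \<bullet> y t0)"
    proof (rule DERIV_nonneg_imp_nondecreasing[OF le])
      fix x assume "t \<le> x" "x \<le> t0"
      then have x: "x \<in> {a..b}" by (auto simp: a_def b_def)
      show "\<exists>d. ((\<lambda>x. exp (1 * (2 * M) * x) * (y x \<bullet> y x)) has_real_derivative d) (at x) \<and> 0 \<le> d"
        by (rule exI, rule conjI, rule der[OF x, of 1], rule mult_nonneg_nonneg) (use bd[OF x] in auto)
    qed
    then show ?thesis using y0 by (simp add: mult_le_0_iff)
  qed
  then show ?thesis by (metis inner_ge_zero inner_eq_zero_iff order_antisym)
qed

text \<open>Only the mixed derivative taken first in t and then in s is assumed; differentiability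
  of \<open>Fs\<close> is part of the conclusion. The symmetry theorem for C2 functions would not
  reach P, which contains a derivative of the variation and is a priori only C1.\<close>

lemma has_vector_derivative_swap_partials:
  fixes F :: "real \<Rightarrow> real \<Rightarrow> 'a::banach"
  assumes I: "open I" "t0 \<in> I" and eps: "0 < e"
    and Ft: "\<And>t s. t \<in> I \<Longrightarrow> \<bar>s\<bar> < e \<Longrightarrow> ((\<lambda>t. F t s) has_vector_derivative G t s) (at t)"
    and Fs: "\<And>t. t \<in> I \<Longrightarrow> ((\<lambda>s. F t s) has_vector_derivative Fs t) (at 0)"
    and Gs: "\<And>t s. t \<in> I \<Longrightarrow> \<bar>s\<bar> < e \<Longrightarrow> ((\<lambda>s. G t s) has_vector_derivative Gs t s) (at s)"
    and cont: "continuous_on (I \<times> {-e<..<e}) (\<lambda>(t, s). Gs t s)"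
  shows "(Fs has_vector_derivative Gs t0 0) (at t0)"
proof -
  obtain r where r: "0 < r" "cball t0 r \<subseteq> I" using I open_contains_cball by blast
  define a b where "a = t0 - r" and "b = t0 + r"
  have ab: "a < t0" "t0 < b" "{a..b} \<subseteq> I"
    using r by (auto simp: a_def b_def cball_eq_atLeastAtMost)
  have int: "((\<lambda>\<tau>. G \<tau> s) has_integral (F t s - F a s)) {a..t}" if "t \<in> {a..b}" "\<bar>s\<bar> < e" for t s
    using that ab by (intro fundamental_theorem_of_calculus has_vector_derivative_at_within[OF Ft]) auto
  have cont0: "continuous_on {a..b} (\<lambda>t. Gs t 0)"
  proof -
    have "continuous_on {a..b} (\<lambda>t. (\<lambda>(t, s). Gs t s) (t, 0))"
      by (rule continuous_on_compose2[OF cont])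
        (use ab eps in \<open>auto intro!: continuous_on_Pair continuous_on_id continuous_on_const\<close>)
    then show ?thesis by simp
  qed
  \<comment> \<open>The integral of \<open>G\<close> over \<open>{a..t}\<close> is differentiated in
    s at 0 twice: under the integral sign, and as an increment of \<open>F\<close>.\<close>
  have eq: "Fs t = Fs a + integral {a..t} (\<lambda>\<tau>. Gs \<tau> 0)" if t: "t \<in> {a..b}" for t
  proof -
    have "((\<lambda>s. integral (cbox a t) (\<lambda>\<tau>. G \<tau> s)) has_vector_derivative
        integral (cbox a t) (\<lambda>\<tau>. Gs \<tau> 0)) (at 0 within {-e<..<e})"
    proof (rule leibniz_rule_vector_derivative)
      show "((\<lambda>s. G \<tau> s) has_vector_derivative Gs \<tau> s) (at s within {-e<..<e})"
        if "s \<in> {-e<..<e}" "\<tau> \<in> cbox a t" for s \<tau>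
        using that t ab by (intro has_vector_derivative_at_within[OF Gs]) auto
      show "(\<lambda>\<tau>. G \<tau> s) integrable_on cbox a t" if "s \<in> {-e<..<e}" for s
        using int[OF t, of s] that by (auto simp: integrable_on_def abs_less_iff)
      show "continuous_on ({-e<..<e} \<times> cbox a t) (\<lambda>(s, \<tau>). Gs \<tau> s)"
        using continuous_on_compose2[OF cont, of "{-e<..<e} \<times> cbox a t" "\<lambda>p. (snd p, fst p)"] t ab
        by (force simp: case_prod_unfold intro!: continuous_intros)
    qed (use eps in auto)
    then have 1: "((\<lambda>s. integral {a..t} (\<lambda>\<tau>. G \<tau> s)) has_vector_derivative
        integral {a..t} (\<lambda>\<tau>. Gs \<tau> 0)) (at 0)"
      using eps by (simp add: at_within_open[of 0 "{-e<..<e}"])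
    have "((\<lambda>s. F t s - F a s) has_vector_derivative Fs t - Fs a) (at 0)"
      using t ab by (intro derivative_intros Fs) auto
    then have 2: "((\<lambda>s. integral {a..t} (\<lambda>\<tau>. G \<tau> s)) has_vector_derivative Fs t - Fs a) (at 0)"
      by (rule has_vector_derivative_transform_within_open[where S="{-e<..<e}"])
        (use eps in \<open>auto intro!: integral_unique[symmetric] int[OF t]\<close>)
    from vector_derivative_unique_at[OF 1 2] show ?thesis by simp
  qed
  have "((\<lambda>t. integral {a..t} (\<lambda>\<tau>. Gs \<tau> 0)) has_vector_derivative Gs t0 0) (at t0)"
    using integral_has_vector_derivative[OF cont0, of t0] ab by (simp add: at_within_Icc_at)
  from has_vector_derivative_add[OF has_vector_derivative_const this, of "Fs a"]
  have "((\<lambda>t. Fs a + integral {a..t} (\<lambda>\<tau>. Gs \<tau> 0)) has_vector_derivative Gs t0 0) (at t0)"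
    by simp
  then show ?thesis
    by (rule has_vector_derivative_transform_within_open[where S="{a<..<b}"])
      (use ab in \<open>auto simp: eq[symmetric]\<close>)
qed

section \<open>The explicit geodesic\<close>

definition geo_D :: "'n::finite mat \<Rightarrow> real \<Rightarrow> real" where
  "geo_D H t = (1 + t/4 * trace H)\<^sup>2 + real CARD('n) / 16 * trace (tf H ** tf H) * t\<^sup>2"

lemma trace_tf [simp]: "trace (tf A) = 0"
  by (simp add: tf_def trace_algebra trace_I)

lemma trace_tf_square:
  fixes H :: "real^'n::finite^'n"
  shows "trace (tf H ** tf H) = trace (H ** H) - (trace H)\<^sup>2 / real CARD('n)"
  by (simp add: tf_def trace_algebra trace_I matrix_mult_algebra) (simp add: field_simps power2_eq_square)

definition geo_D' :: "'n::finite mat \<Rightarrow> real \<Rightarrow> real" where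
  "geo_D' H t = trace H / 2 + real CARD('n) / 8 * trace (H ** H) * t"

lemma geo_D_eq:
  fixes H :: "real^'n::finite^'n"
  shows "geo_D H t = 1 + trace H / 2 * t + real CARD('n) / 16 * trace (H ** H) * t\<^sup>2"
  unfolding geo_D_def trace_tf_square by (simp add: field_simps power2_eq_square)

lemma has_real_derivative_geo_D:
  "(geo_D H has_real_derivative geo_D' H t) (at t)"
  unfolding geo_D_eq[abs_def] geo_D'_def by (auto intro!: derivative_eq_intros)

lemma has_real_derivative_geo_D':
  fixes H :: "real^'n::finite^'n"
  shows "(geo_D' H has_real_derivative real CARD('n) / 8 * trace (H ** H)) (at t)"
  unfolding geo_D'_def[abs_def] by (auto intro!: derivative_eq_intros)

text \<open>For a quadratic polynomial D the expression 2 D D'' - D'^2 is constant, namely minus the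
  discriminant. This is how tr(H_0^2) enters the differential equations.\<close>

lemma geo_D_discriminant:
  fixes H :: "real^'n::finite^'n"
  shows "2 * geo_D H t * (real CARD('n) / 8 * trace (H ** H)) - (geo_D' H t)\<^sup>2
     = real CARD('n) / 4 * trace (tf H ** tf H)"
  unfolding geo_D_eq geo_D'_def trace_tf_square by (simp add: field_simps power2_eq_square)

text \<open>Away from t = 0 the branches of the arctangent are glued by a single smooth formula.\<close>
lemma geo_b_eq_arctan_inverse:
  fixes H :: "real^'n::finite^'n"
  assumes "0 < trace (tf H ** tf H)" "t \<noteq> 0"
  defines "s \<equiv> sqrt (real CARD('n) * trace (tf H ** tf H))"
  shows "geo_b H t = 4 / s * (sgn t * (pi/2) - arctan ((4 + t * trace H) / (s * t)))"
proof -
  define x where "x = (4 + t * trace H) / (s * t)"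
  have s: "0 < s" using assms by (simp add: s_def)
  have inv: "s * t / (4 + t * trace H) = 1 / x" by (simp add: x_def)
  have sx: "sgn x = sgn (4 + t * trace H) * sgn t"
    using s by (simp add: x_def sgn_divide sgn_mult)
  consider "0 < 4 + t * trace H" | "4 + t * trace H = 0" | "4 + t * trace H < 0" by linarith
  then show ?thesis
  proof cases
    case 1
    then have "x \<noteq> 0" using s assms by (simp add: x_def)
    then have "arctan (1 / x) = sgn t * (pi/2) - arctan x"
      using 1 sx Transcendental.arctan_inverse[of x] by simp
    with 1 show ?thesis using assms(1)
      by (simp add: geo_b_def Let_def s_def[symmetric] inv x_def[symmetric])
  next
    case 2
    then show ?thesis using assms(1) by (simp add: geo_b_def Let_def s_def[symmetric])
  next
    case 3
    then have "x \<noteq> 0" using s assms by (simp add: x_def)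
    then have "arctan (1 / x) = - (sgn t * (pi/2)) - arctan x"
      using 3 sx Transcendental.arctan_inverse[of x] by simp
    with 3 show ?thesis using assms(1)
      by (simp add: geo_b_def Let_def s_def[symmetric] inv x_def[symmetric])
  qed
qed

text \<open>One formula covers the degenerate case and all branches of the arctangent. Later
  arguments know b only through b' = 1/D and b(0) = 0.\<close>

lemma has_real_derivative_geo_b:
  fixes H :: "real^'n::finite^'n"
  assumes nn: "0 \<le> trace (tf H ** tf H)" and D: "0 < geo_D H t"
  shows "(geo_b H has_real_derivative 1 / geo_D H t) (at t)"
proof (cases "trace (tf H ** tf H) = 0")
  case True
  then have "1 + t/4 * trace H \<noteq> 0" "geo_D H t = (1 + t/4 * trace H)\<^sup>2"
    using D by (auto simp: geo_D_def)
  moreover have "geo_b H = (\<lambda>t. t / (1 + t/4 * trace H))"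
    using True by (auto simp: geo_b_def)
  ultimately show ?thesis
    by (auto intro!: derivative_eq_intros simp: power2_eq_square)
next
  case False
  then have pos: "0 < trace (tf H ** tf H)" using nn by simp
  define s where "s = sqrt (real CARD('n) * trace (tf H ** tf H))"
  have s: "0 < s" "s\<^sup>2 = real CARD('n) * trace (tf H ** tf H)" using pos by (auto simp: s_def)
  have D16: "geo_D H t = ((4 + t * trace H)\<^sup>2 + s\<^sup>2 * t\<^sup>2) / 16" for t
    unfolding geo_D_def s(2) by (simp add: field_simps power2_eq_square)
  show ?thesis
  \<comment> \<open>The inverted arctangent formula is singular at 0, but near 0 the denominator 4 +
    t tr H is positive and only the first branch occurs. Elsewhere the sign of t is locally
    constant.\<close>
  proof (cases "t = 0")
    case True
    have o: "open {t. 0 < 4 + t * trace H}"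
      by (intro open_Collect_less continuous_intros)
    have "((\<lambda>t. 4 / s * arctan (s * t / (4 + t * trace H))) has_real_derivative 1 / geo_D H t) (at t)"
      using True s by (auto intro!: derivative_eq_intros simp: geo_D_def)
    then show ?thesis
      by (rule has_field_derivative_transform_within_open[OF _ o])
        (use True False in \<open>auto simp: geo_b_def Let_def s_def\<close>)
  next
    case t0: False
    define \<sigma> where "\<sigma> = sgn t"
    have o: "open {x. 0 < x * \<sigma>}"
      by (intro open_Collect_less continuous_intros)
    have D0: "(4 + t * trace H)\<^sup>2 + s\<^sup>2 * t\<^sup>2 \<noteq> 0" using D D16[of t] by simp
    have key: "4 / s * - (inverse (1 + ((4 + t * trace H) / (s * t))\<^sup>2) *
         ((trace H * (s * t) - (4 + t * trace H) * s) / (s * t * (s * t)))) = 1 / geo_D H t"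
    proof -
      have "1 + ((4 + t * trace H) / (s * t))\<^sup>2 = ((4 + t * trace H)\<^sup>2 + s\<^sup>2 * t\<^sup>2) / (s * t)\<^sup>2"
        using s(1) t0 by (simp add: field_simps power_mult_distrib)
      moreover have "trace H * (s * t) - (4 + t * trace H) * s = - (4 * s)" by (simp add: algebra_simps)
      ultimately show ?thesis unfolding D16 using s t0
        by (simp add: power2_eq_square)
    qed
    have q: "((\<lambda>t. (4 + t * trace H) / (s * t)) has_real_derivative
       (trace H * (s * t) - (4 + t * trace H) * s) / (s * t * (s * t))) (at t)"
      by (rule derivative_eq_intros refl | use t0 s in simp)+
    have "((\<lambda>t. 4 / s * (\<sigma> * (pi/2) - arctan ((4 + t * trace H) / (s * t)))) has_real_derivative
       4 / s * - (inverse (1 + ((4 + t * trace H) / (s * t))\<^sup>2) *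
         ((trace H * (s * t) - (4 + t * trace H) * s) / (s * t * (s * t))))) (at t)"
      using DERIV_cmult[OF DERIV_diff[OF DERIV_const DERIV_chain2[OF DERIV_arctan q]],
          of "4 / s" "\<sigma> * (pi/2)"] by simp
    then show ?thesis unfolding key
    proof (rule has_field_derivative_transform_within_open[OF _ o])
      show "t \<in> {x. 0 < x * \<sigma>}" using t0 by (simp add: \<sigma>_def sgn_real_def)
      fix x assume "x \<in> {x. 0 < x * \<sigma>}"
      then have "x \<noteq> 0" "sgn x = \<sigma>" by (auto simp: \<sigma>_def sgn_real_def zero_less_mult_iff split: if_splits)
      then show "4 / s * (\<sigma> * (pi/2) - arctan ((4 + x * trace H) / (s * x))) = geo_b H x"
        using geo_b_eq_arctan_inverse[OF pos, of x] by (simp add: s_def)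
    qed
  qed
qed

lemma has_real_derivative_geo_a:
  fixes H :: "real^'n::finite^'n"
  assumes D: "0 < geo_D H t"
  shows "(geo_a H has_real_derivative 2 * geo_D' H t / (real CARD('n) * geo_D H t)) (at t)"
proof -
  have "geo_a H = (\<lambda>t. (2 / real CARD('n)) * ln (geo_D H t))"
    by (simp add: geo_a_def[abs_def] geo_D_def)
  then show ?thesis using D
    by (auto intro!: derivative_eq_intros has_real_derivative_geo_D simp: divide_inverse)
qed

lemma exp_geo_a:
  fixes H :: "real^'n::finite^'n"
  assumes "0 < geo_D H t"
  shows "exp (- real CARD('n) / 2 * geo_a H t) = 1 / geo_D H t"
proof -
  have "- real CARD('n) / 2 * geo_a H t = - ln (geo_D H t)"
    by (simp add: geo_a_def geo_D_def)
  then show ?thesis using assms by (simp add: exp_minus inverse_eq_divide)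
qed

lemma Pgeo_eq:
  fixes H :: "real^'n::finite^'n"
  assumes "0 < geo_D H t"
  shows "Pgeo H t = (2 * geo_D' H t / (real CARD('n) * geo_D H t)) *\<^sub>R mat 1 + (1 / geo_D H t) *\<^sub>R tf H"
  unfolding Pgeo_def exp_geo_a[OF assms] geo_D'_def
  using assms by (simp add: scaleR_add_right field_simps)

text \<open>H_0 is trace-free, so the trace fixes the coefficient of Id; orthogonality to P then
  fixes that of H_0, after a division by tr(H_0^2).\<close>

lemma Pperp_eq:
  fixes H :: "real^'n::finite^'n"
  assumes D: "0 < geo_D H t" and nz: "trace (tf H ** tf H) \<noteq> 0"
  shows "Pperp H t = (1 / (real CARD('n) * geo_D H t)) *\<^sub>R mat 1
     - (2 * geo_D' H t / (real CARD('n) * trace (tf H ** tf H) * geo_D H t)) *\<^sub>R tf H"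
  unfolding Pperp_def exp_geo_a[OF D] Pgeo_eq[OF D]
proof (rule the_equality, goal_cases)
  case 1
  show ?case
    using D nz
    by (intro conjI exI[of _ "1 / (real CARD('n) * geo_D H t)"]
          exI[of _ "- (2 * geo_D' H t / (real CARD('n) * trace (tf H ** tf H) * geo_D H t))"])
       (simp_all add: trace_algebra trace_I matrix_mult_algebra)
next
  case (2 X)
  then obtain x y where X: "X = x *\<^sub>R mat 1 + y *\<^sub>R tf H" by blast
  have x: "x = 1 / (real CARD('n) * geo_D H t)"
    using 2 D by (simp add: X trace_algebra trace_I field_simps)
  have "2 * geo_D' H t * x / geo_D H t + y * trace (tf H ** tf H) / geo_D H t = 0"
    using 2 D by (simp add: X trace_algebra trace_I matrix_mult_algebra mult_ac)
  then have "y = - (2 * geo_D' H t * x / trace (tf H ** tf H))"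
    using D nz by (simp add: field_simps add_eq_0_iff)
  then show ?case by (simp add: X x mult_ac)
qed

section \<open>Matrix exponential and velocity of the geodesic\<close>

lemma norm_funpow_bound:
  fixes T :: "'a::real_normed_vector \<Rightarrow> 'a"
  assumes "\<And>x. norm (T x) \<le> norm x * C" "0 \<le> C"
  shows "norm ((T ^^ m) v) \<le> norm v * C ^ m"
proof (induction m)
  case (Suc m)
  have "norm ((T ^^ Suc m) v) \<le> norm ((T ^^ m) v) * C" using assms(1) by simp
  also have "\<dots> \<le> norm v * C ^ m * C" using Suc assms(2) by (rule mult_right_mono)
  finally show ?case by (simp add: mult_ac)
qed simp

lemma mpow_eq_funpow: "mpow A m = (((**) A) ^^ m) (mat 1)"
  by (induction m) auto

lemma mpow_commute: "A ** mpow A m = mpow A m ** A"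
proof (induction m)
  case (Suc m)
  then have "A ** (A ** mpow A m) = A ** (mpow A m ** A)" by simp
  then show ?case by (simp add: matrix_mul_assoc)
qed simp

lemma mpow_bound:
  fixes A :: "'n::finite mat"
  obtains C where "\<And>m. norm (mpow A m) \<le> norm (mat 1 :: 'n mat) * C ^ m"
proof -
  obtain C where "0 \<le> C" "\<And>x::'n mat. norm (A ** x) \<le> norm x * C"
    using bounded_linear.nonneg_bounded[OF bounded_bilinear.bounded_linear_right[OF bounded_bilinear_matrix_mult, of A]]
    by blast
  then show ?thesis by (intro that[of C]) (simp add: mpow_eq_funpow norm_funpow_bound)
qed

lemma mexp_scaleR: "mexp (x *\<^sub>R A) = (\<Sum>m. (x ^ m / fact m) *\<^sub>R mpow A m)"
proof -
  have "mpow (x *\<^sub>R A) m = x ^ m *\<^sub>R mpow A m" for m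
    by (induction m) (simp_all add: matrix_mult_algebra mult_ac)
  then show ?thesis by (simp add: mexp_def)
qed

lemma summable_mexp: "summable (\<lambda>m. (x ^ m / fact m) *\<^sub>R mpow A m)"
  by (rule mpow_bound[of A]) (rule summable_exponential_series)

lemma mexp_mult_left: "(\<Sum>m. (x ^ m / fact m) *\<^sub>R (A ** mpow A m)) = A ** mexp (x *\<^sub>R A)"
  unfolding mexp_scaleR
  by (subst bounded_linear.suminf[OF bounded_bilinear.bounded_linear_right[OF bounded_bilinear_matrix_mult] summable_mexp])
    (simp add: matrix_mult_algebra)

lemma mexp_commute: "A ** mexp (x *\<^sub>R A) = mexp (x *\<^sub>R A) ** A"
  unfolding mexp_mult_left[symmetric] unfolding mexp_scaleR
  by (subst bounded_linear.suminf[OF bounded_bilinear.bounded_linear_left[OF bounded_bilinear_matrix_mult] summable_mexp])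
    (simp add: matrix_mult_algebra mpow_commute)

lemma has_vector_derivative_mexp:
  fixes A :: "'n::finite mat"
  shows "((\<lambda>x. mexp (x *\<^sub>R A)) has_vector_derivative A ** mexp (x *\<^sub>R A)) (at x)"
proof -
  obtain C where "\<And>m. norm (mpow A m) \<le> norm (mat 1 :: 'n mat) * C ^ m" using mpow_bound[of A] by blast
  from has_vector_derivative_exponential_series[OF this, of x]
  show ?thesis by (simp add: mexp_scaleR[symmetric] mexp_mult_left)
qed

lemma mexp_0 [simp]: "mexp 0 = mat 1"
proof -
  have "mexp (0 *\<^sub>R (0 :: 'a mat)) = (\<Sum>m\<in>{0::nat}. (0 ^ m / fact m) *\<^sub>R mpow 0 m)"
    unfolding mexp_scaleR by (intro suminf_finite) auto
  then show ?thesis by simp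
qed

text \<open>Along the ray t B with B = c Id + A both sides solve X' = B X with X(0) = Id, so
  uniqueness replaces a product of two series. It splits off the conformal factor e^a of the
  geodesic.\<close>

lemma mexp_add_scalar: 
  fixes A :: "real^'n::finite^'n"
  shows "mexp (c *\<^sub>R mat 1 + A) = exp c *\<^sub>R mexp A"
proof -
  define B where "B = c *\<^sub>R mat 1 + A"
  obtain C where C: "\<And>X::real^'n^'n. norm (B ** X) \<le> norm X * C"
    using bounded_linear.bounded[OF bounded_bilinear.bounded_linear_right[OF bounded_bilinear_matrix_mult, of B]] by blast
  have BX: "B ** X = c *\<^sub>R X + A ** X" for X :: "real^'n^'n"
    by (simp add: B_def matrix_mult_algebra)
  have "mexp (1 *\<^sub>R B) - exp (c * 1) *\<^sub>R mexp (1 *\<^sub>R A) = 0"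
  proof (rule linear_ode_unique_zero[where I = UNIV and ?t0.0 = 0 and c = "\<lambda>_. C"])
    fix t
    have "((\<lambda>t. exp (c * t)) has_real_derivative exp (c * t) * c) (at t)"
      by (auto intro!: derivative_eq_intros)
    from has_vector_derivative_diff[OF has_vector_derivative_mexp has_vector_derivative_scaleR[OF this has_vector_derivative_mexp], of B A]
    show "((\<lambda>t. mexp (t *\<^sub>R B) - exp (c * t) *\<^sub>R mexp (t *\<^sub>R A)) has_vector_derivative
      B ** (mexp (t *\<^sub>R B) - exp (c * t) *\<^sub>R mexp (t *\<^sub>R A))) (at t)"
      by (simp add: matrix_mult_algebra algebra_simps BX[of "mexp (t *\<^sub>R A)"])
    show "norm (B ** (mexp (t *\<^sub>R B) - exp (c * t) *\<^sub>R mexp (t *\<^sub>R A)))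
       \<le> C * norm (mexp (t *\<^sub>R B) - exp (c * t) *\<^sub>R mexp (t *\<^sub>R A))"
      using C by (metis mult.commute)
  qed auto
  then show ?thesis by (simp add: B_def)
qed

text \<open>Since \<open>tf H\<close> commutes with its exponential, the factor a' Id + b' H_0 can
  be moved to the right of g, where it is \<open>Pgeo\<close>.\<close>

lemma has_vector_derivative_geo:
  fixes g0 h :: "real^'n::finite^'n"
  defines "H \<equiv> matrix_inv g0 ** h"
  assumes nn: "0 \<le> trace (tf H ** tf H)" and D: "0 < geo_D H t"
  shows "(geo g0 h has_vector_derivative geo g0 h t ** Pgeo H t) (at t)"
proof -
  have g: "geo g0 h = (\<lambda>t. g0 ** (exp (geo_a H t) *\<^sub>R mexp (geo_b H t *\<^sub>R tf H)))"
    by (simp add: geo_def[abs_def] H_def[symmetric] Let_def mexp_add_scalar)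
  have a: "((\<lambda>t. exp (geo_a H t)) has_real_derivative
     exp (geo_a H t) * (2 * geo_D' H t / (real CARD('n) * geo_D H t))) (at t)"
    by (rule DERIV_fun_exp[OF has_real_derivative_geo_a[OF D]])
  have b: "((\<lambda>t. mexp (geo_b H t *\<^sub>R tf H)) has_vector_derivative
      (1 / geo_D H t) *\<^sub>R (tf H ** mexp (geo_b H t *\<^sub>R tf H))) (at t)"
    using vector_diff_chain_at[OF has_real_derivative_geo_b[OF nn D, unfolded has_real_derivative_iff_has_vector_derivative]
       has_vector_derivative_mexp[of "tf H"]]
    by (simp add: o_def)
  have "((\<lambda>t. g0 ** (exp (geo_a H t) *\<^sub>R mexp (geo_b H t *\<^sub>R tf H))) has_vector_derivative
     g0 ** (exp (geo_a H t) *\<^sub>R ((1 / geo_D H t) *\<^sub>R (tf H ** mexp (geo_b H t *\<^sub>R tf H)))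
      + (exp (geo_a H t) * (2 * geo_D' H t / (real CARD('n) * geo_D H t))) *\<^sub>R mexp (geo_b H t *\<^sub>R tf H))) (at t)"
    by (intro bounded_linear.has_vector_derivative[OF bounded_bilinear.bounded_linear_right[OF bounded_bilinear_matrix_mult]]
         has_vector_derivative_scaleR a b)
  then show ?thesis
    unfolding g Pgeo_eq[OF D] by (simp add: matrix_mult_algebra mexp_commute matrix_mul_assoc[symmetric] algebra_simps)
qed

lemma geo_0: 
  fixes g0 :: "real^'n::finite^'n"
  shows "geo g0 h 0 = g0"
proof -
  have "geo_a H 0 = 0" "geo_b H 0 = 0" for H :: "real^'n^'n"
    by (simp_all add: geo_a_def geo_b_def Let_def)
  then show ?thesis by (simp add: geo_def Let_def)
qed

section \<open>Linearised geodesic equation\<close>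

text \<open>Along a geodesic, P = matrix_inv g ** g' satisfies P' = tr(PP)/4 Id - tr(P)/2 P; this is the
  linearisation of the right-hand side at P.\<close>
definition lin_rhs :: "'n::finite mat \<Rightarrow> 'n mat \<Rightarrow> 'n mat" where
  "lin_rhs P Q = (1/2 * trace (P ** Q)) *\<^sub>R mat 1 - (1/2 * trace Q) *\<^sub>R P - (1/2 * trace P) *\<^sub>R Q"

lemma bounded_bilinear_lin_rhs: "bounded_bilinear (lin_rhs :: 'n::finite mat \<Rightarrow> _)"
proof -
  have "bilinear (lin_rhs :: 'n mat \<Rightarrow> _)"
    unfolding bilinear_def linear_iff lin_rhs_def
    by (auto simp: matrix_mult_algebra trace_algebra scaleR_add_left scaleR_add_right scaleR_diff_right add_divide_distrib
        algebra_simps)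
  then show ?thesis by (simp add: bilinear_conv_bounded_bilinear)
qed

lemma Christ_commute: "Christ g h k = Christ g k h"
proof -
  have "trace (matrix_inv g ** h ** matrix_inv g ** k) = trace (matrix_inv g ** k ** matrix_inv g ** h)"
    by (metis matrix_mul_assoc trace_mul_sym)
  then show ?thesis by (simp add: Christ_def)
qed

text \<open>P' is \<open>matrix_inv g ** g''\<close> minus \<open>P ** P\<close>, so the leading
  square cancels and an equation for P alone remains.\<close>

lemma matrix_inv_Christ:
  fixes g X :: "real^'n::finite^'n"
  assumes "invertible g"
  defines "P \<equiv> matrix_inv g ** X"
  shows "matrix_inv g ** Christ g X X
    = P ** P + (1/4 * trace (P ** P)) *\<^sub>R mat 1 - (1/2 * trace P) *\<^sub>R P"
proof -
  have "matrix_inv g ** Christ g X X = (1/2) *\<^sub>R (P ** P) + (1/2) *\<^sub>R (P ** P)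
     + (1/4 * trace (P ** P)) *\<^sub>R mat 1 - (1/4 * trace P) *\<^sub>R P - (1/4 * trace P) *\<^sub>R P"
    unfolding Christ_def matrix_mult_algebra P_def by (simp add: matrix_mul_assoc matrix_inv_left_right[OF assms(1)])
  also have "\<dots> = P ** P + (1/4 * trace (P ** P)) *\<^sub>R mat 1 - (1/2 * trace P) *\<^sub>R P"
    by (simp add: vec_eq_iff)
  finally show ?thesis .
qed

lemma continuous_on_matrix_inv_compose:
  fixes f :: "'a::topological_space \<Rightarrow> real^'n::finite^'n"
  assumes "continuous_on S f" "\<And>x. x \<in> S \<Longrightarrow> invertible (f x)"
  shows "continuous_on S (\<lambda>x. matrix_inv (f x))"
  by (rule continuous_on_compose2[OF continuous_on_matrix_inv assms(1)]) (use assms in auto)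

lemma has_vector_derivative_trace:
  fixes f :: "real \<Rightarrow> real^'n::finite^'n"
  shows "(f has_vector_derivative f') (at x) \<Longrightarrow> ((\<lambda>x. trace (f x)) has_vector_derivative trace f') (at x)"
  by (rule bounded_linear.has_vector_derivative[OF bounded_linear_trace])

text \<open>The interchange of partial derivatives is used twice: for \<alpha> it gives J', for P it
  gives Q'. As \<open>P\<close> is prescribed only at s = 0, the proof rebuilds it as
  \<open>PP\<close> for all s.\<close>

lemma geodesic_variation:
  fixes \<alpha> :: "real \<times> real \<Rightarrow> real^'n::finite^'n" and P :: "real \<Rightarrow> real^'n^'n"
  assumes I: "open I" and eps: "0 < e"
    and smooth: "C2_on \<alpha> (I \<times> {-e<..<e})"
    and geod: "\<And>s. s \<in> {-e<..<e} \<Longrightarrow> is_geodesic (\<lambda>t. \<alpha> (t, s)) I"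
    and P: "\<And>t. t \<in> I \<Longrightarrow> ((\<lambda>t. \<alpha> (t, 0)) has_vector_derivative \<alpha> (t, 0) ** P t) (at t)"
  obtains J Q where
    "\<And>t. t \<in> I \<Longrightarrow> ((\<lambda>s. \<alpha> (t, s)) has_vector_derivative J t) (at 0)"
    "\<And>t. t \<in> I \<Longrightarrow> (J has_vector_derivative J t ** P t + \<alpha> (t, 0) ** Q t) (at t)"
    "\<And>t. t \<in> I \<Longrightarrow> (Q has_vector_derivative lin_rhs (P t) (Q t)) (at t)"
proof -
  let ?S = "I \<times> {-e<..<e}"
  obtain f' :: "real \<times> real \<Rightarrow> (real \<times> real) \<Rightarrow>\<^sub>L (real^'n^'n)"
    and f'' :: "real \<times> real \<Rightarrow> (real \<times> real) \<Rightarrow>\<^sub>L ((real \<times> real) \<Rightarrow>\<^sub>L (real^'n^'n))"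
    where f': "\<And>x. x \<in> ?S \<Longrightarrow> (\<alpha> has_derivative blinfun_apply (f' x)) (at x)"
      and f'': "\<And>x. x \<in> ?S \<Longrightarrow> (f' has_derivative blinfun_apply (f'' x)) (at x)"
      and cf'': "continuous_on ?S f''"
    using smooth unfolding C2_on_def by blast
  define At where "At p = f' p (1, 0)" for p
  define As where "As p = f' p (0, 1)" for p
  define Ats where "Ats p = f'' p (0, 1) (1, 0)" for p
  have c\<alpha>: "continuous_on ?S \<alpha>"
    by (intro continuous_at_imp_continuous_on ballI has_derivative_continuous[OF f'])
  have cf': "continuous_on ?S f'"
    by (intro continuous_at_imp_continuous_on ballI has_derivative_continuous[OF f''])
  have cAt: "continuous_on ?S At" and cAs: "continuous_on ?S As" and cAts: "continuous_on ?S Ats"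
    unfolding At_def As_def Ats_def by (intro continuous_intros cf' cf'')+
  have pt: "((\<lambda>t. (t, s)) has_derivative (\<lambda>h. (h, 0))) (at t)"
    and ps: "((\<lambda>s. (t, s)) has_derivative (\<lambda>h. (0, h))) (at s)" for t s :: real
    by (auto intro!: derivative_eq_intros)
  have scale_t: "(\<lambda>h. blinfun_apply F (h, 0)) = (\<lambda>h. h *\<^sub>R blinfun_apply F (1, 0))"
    and scale_s: "(\<lambda>h. blinfun_apply F (0, h)) = (\<lambda>h. h *\<^sub>R blinfun_apply F (0, 1))"
    for F :: "(real \<times> real) \<Rightarrow>\<^sub>L 'b::real_normed_vector"
    by (simp_all add: blinfun.scaleR_right[symmetric])
  have dt: "((\<lambda>t. \<alpha> (t, s)) has_vector_derivative At (t, s)) (at t)" if "(t, s) \<in> ?S" for t s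
    using has_derivative_compose[OF pt f'[OF that]]
    by (simp add: scale_t has_vector_derivative_def At_def)
  have ds: "((\<lambda>s. \<alpha> (t, s)) has_vector_derivative As (t, s)) (at s)" if "(t, s) \<in> ?S" for t s
    using has_derivative_compose[OF ps f'[OF that]]
    by (simp add: scale_s has_vector_derivative_def As_def)
  have dts: "((\<lambda>s. At (t, s)) has_vector_derivative Ats (t, s)) (at s)" if "(t, s) \<in> ?S" for t s
  proof -
    have "((\<lambda>s. f' (t, s)) has_derivative (\<lambda>h. h *\<^sub>R f'' (t, s) (0, 1))) (at s)"
      using has_derivative_compose[OF ps f''[OF that]] by (simp add: scale_s)
    from bounded_linear.has_derivative[OF blinfun.bounded_linear_left this, of "(1, 0)"]
    show ?thesis unfolding has_vector_derivative_def At_def Ats_def by (simp add: blinfun.scaleR_left)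
  qed
  have inv: "invertible (\<alpha> (t, s))" and
    dtt: "((\<lambda>t. At (t, s)) has_vector_derivative Christ (\<alpha> (t, s)) (At (t, s)) (At (t, s))) (at t)"
    if ts: "(t, s) \<in> ?S" for t s
  proof -
    obtain c' c'' where c: "\<And>t. t \<in> I \<Longrightarrow> posdef_sym (\<alpha> (t, s))
       \<and> ((\<lambda>t. \<alpha> (t, s)) has_vector_derivative c' t) (at t)
       \<and> (c' has_vector_derivative c'' t) (at t) \<and> c'' t = Christ (\<alpha> (t, s)) (c' t) (c' t)"
      using geod[of s] ts unfolding is_geodesic_def by blast
    show "invertible (\<alpha> (t, s))" using c ts posdef_sym_invertible by blast
    \<comment> \<open>The velocity \<open>c'\<close> provided by \<open>is_geodesic\<close> is
      chosen separately for each s; uniqueness of derivatives identifies it with \<open>At\<close>,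
      which is differentiable in s.\<close>
    have eq: "c' x = At (x, s)" if "x \<in> I" for x
      using c[OF that] dt[of x s] ts that by (auto intro: vector_derivative_unique_at)
    have "(c' has_vector_derivative Christ (\<alpha> (t, s)) (At (t, s)) (At (t, s))) (at t)"
      using c[of t] ts eq by auto
    then show "((\<lambda>t. At (t, s)) has_vector_derivative Christ (\<alpha> (t, s)) (At (t, s)) (At (t, s))) (at t)"
      by (rule has_vector_derivative_transform_within_open[OF _ I]) (use ts eq in auto)
  qed
  define PP where "PP p = matrix_inv (\<alpha> p) ** At p" for p
  \<comment> \<open>The s-derivative of \<open>PP\<close>, written out so that its continuity is
    visible.\<close>
  define QQ where "QQ p = matrix_inv (\<alpha> p) ** Ats p - matrix_inv (\<alpha> p) ** As p ** PP p" for p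
  have cinv: "continuous_on ?S (\<lambda>p. matrix_inv (\<alpha> p))"
    by (rule continuous_on_matrix_inv_compose[OF c\<alpha>]) (use inv in auto)
  have cPP: "continuous_on ?S PP" unfolding PP_def
    by (intro continuous_on_matrix_mult cinv cAt)
  have cQQ: "continuous_on ?S QQ" unfolding QQ_def
    by (intro continuous_on_diff continuous_on_matrix_mult cinv cAs cAts cPP)
  have PPs: "((\<lambda>s. PP (t, s)) has_vector_derivative QQ (t, s)) (at s)" if ts: "(t, s) \<in> ?S" for t s
    using has_vector_derivative_matrix_mult[OF has_vector_derivative_matrix_inv[OF inv[OF ts] ds[OF ts]] dts[OF ts]]
    by (simp add: PP_def QQ_def matrix_mult_algebra matrix_mul_assoc)
  have PPt: "((\<lambda>t. PP (t, s)) has_vector_derivative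
      (1/4 * trace (PP (t, s) ** PP (t, s))) *\<^sub>R mat 1 - (1/2 * trace (PP (t, s))) *\<^sub>R PP (t, s)) (at t)"
    if ts: "(t, s) \<in> ?S" for t s
  proof -
    have "((\<lambda>t. PP (t, s)) has_vector_derivative matrix_inv (\<alpha> (t, s)) ** Christ (\<alpha> (t, s)) (At (t, s)) (At (t, s))
        - PP (t, s) ** PP (t, s)) (at t)"
      using has_vector_derivative_matrix_mult[OF has_vector_derivative_matrix_inv[OF inv[OF ts] dt[OF ts]] dtt[OF ts]]
      by (simp add: PP_def matrix_mult_algebra matrix_mul_assoc)
    then show ?thesis
      unfolding matrix_inv_Christ[OF inv[OF ts]] by (simp add: PP_def)
  qed
  have Gs: "((\<lambda>s. (1/4 * trace (PP (t, s) ** PP (t, s))) *\<^sub>R mat 1 - (1/2 * trace (PP (t, s))) *\<^sub>R PP (t, s))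
      has_vector_derivative lin_rhs (PP (t, s)) (QQ (t, s))) (at s)" if ts: "(t, s) \<in> ?S" for t s
  proof -
    have tr2: "((\<lambda>s. trace (PP (t, s) ** PP (t, s))) has_real_derivative 2 * trace (PP (t, s) ** QQ (t, s))) (at s)"
      using has_vector_derivative_trace[OF has_vector_derivative_matrix_mult[OF PPs[OF ts] PPs[OF ts]]]
      by (simp add: has_real_derivative_iff_has_vector_derivative trace_algebra
          trace_mul_sym[of "QQ (t, s)" "PP (t, s)"])
    have tr1: "((\<lambda>s. trace (PP (t, s))) has_real_derivative trace (QQ (t, s))) (at s)"
      using has_vector_derivative_trace[OF PPs[OF ts]]
      by (simp add: has_real_derivative_iff_has_vector_derivative)
    show ?thesis
      using has_vector_derivative_diff[OF
        has_vector_derivative_scaleR[OF DERIV_cmult[OF tr2, of "1/4"] has_vector_derivative_const[of "mat 1"]]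
        has_vector_derivative_scaleR[OF DERIV_cmult[OF tr1, of "1/2"] PPs[OF ts]]]
      by (simp add: lin_rhs_def algebra_simps)
  qed
  have in0: "(t, s) \<in> ?S \<longleftrightarrow> t \<in> I \<and> \<bar>s\<bar> < e" for t s by auto
  have P0: "P t = PP (t, 0)" if t: "t \<in> I" for t
  proof -
    have S: "(t, 0) \<in> ?S" using t eps by simp
    have "At (t, 0) = \<alpha> (t, 0) ** P t"
      by (rule vector_derivative_unique_at[OF dt[OF S] P[OF t]])
    then show ?thesis by (simp add: PP_def matrix_mul_assoc matrix_inv_left_right[OF inv[OF S]])
  qed
  show ?thesis
  proof (rule that[of "\<lambda>t. As (t, 0)" "\<lambda>t. QQ (t, 0)"])
    fix t assume t: "t \<in> I"
    have S: "(t, 0) \<in> ?S" using t eps by simp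
    show "((\<lambda>s. \<alpha> (t, s)) has_vector_derivative As (t, 0)) (at 0)" by (rule ds[OF S])
    have "((\<lambda>t. As (t, 0)) has_vector_derivative Ats (t, 0)) (at t)"
      by (rule has_vector_derivative_swap_partials[OF I t eps, where F = "\<lambda>t s. \<alpha> (t, s)"
             and Gs = "\<lambda>t s. Ats (t, s)", OF dt ds dts])
        (use cAts eps in \<open>auto simp: in0\<close>)
    moreover have "Ats (t, 0) = As (t, 0) ** P t + \<alpha> (t, 0) ** QQ (t, 0)"
      by (simp add: QQ_def matrix_mult_algebra matrix_mul_assoc matrix_inv_left_right[OF inv[OF S]] P0[OF t])
    ultimately show "((\<lambda>t. As (t, 0)) has_vector_derivative As (t, 0) ** P t + \<alpha> (t, 0) ** QQ (t, 0)) (at t)"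
      by simp
    have "continuous_on ?S (\<lambda>p. lin_rhs (PP p) (QQ p))"
      by (intro bounded_bilinear.continuous_on[OF bounded_bilinear_lin_rhs] cPP cQQ)
    then have "((\<lambda>t. QQ (t, 0)) has_vector_derivative lin_rhs (PP (t, 0)) (QQ (t, 0))) (at t)"
      by (intro has_vector_derivative_swap_partials[OF I t eps, where F = "\<lambda>t s. PP (t, s)"
             and Gs = "\<lambda>t s. lin_rhs (PP (t, s)) (QQ (t, s))", OF PPt PPs Gs])
        (use eps in \<open>auto simp: in0 case_prod_unfold\<close>)
    then show "((\<lambda>t. QQ (t, 0)) has_vector_derivative lin_rhs (P t) (QQ (t, 0))) (at t)"
      by (simp add: P0[OF t])
  qed
qed

section \<open>Explicit Jacobi fields\<close>

text \<open>W x is (exp(x T) - 1) / T applied to V.\<close>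
lemma has_vector_derivative_exp_minus_one_series:
  fixes T :: "'a::euclidean_space \<Rightarrow> 'a" and V :: 'a
  assumes T: "linear T"
  defines "W \<equiv> \<lambda>x. x *\<^sub>R V + (\<Sum>m. (x ^ (m + 2) / fact (m + 2)) *\<^sub>R (T ^^ (m + 1)) V)"
  shows "(W has_vector_derivative V + T (W x)) (at x)"
proof -
  \<comment> \<open>The shift by one power realises the division by \<open>T\<close>: x^m / m! gets
    the coefficient T^(m-1) V, and 0 for m = 0.\<close>
  define c where "c m = (if m = 0 then 0 else (T ^^ (m - 1)) V)" for m
  have bl: "bounded_linear T" using T by (simp add: linear_conv_bounded_linear)
  obtain C0 where C0: "\<And>x. norm (T x) \<le> norm x * C0" "0 \<le> C0"
    using bounded_linear.nonneg_bounded[OF bl] by blast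
  \<comment> \<open>Adding 1 ensures C \<ge> 1, so that the bound C^(m-1) can be weakened to
    C^m.\<close>
  define C where "C = C0 + 1"
  have C: "norm (T x) \<le> norm x * C" "1 \<le> C" for x
    using C0(1)[of x] C0(2) norm_ge_zero[of x] by (auto simp: C_def distrib_left intro: add_increasing2)
  have cb: "norm (c m) \<le> norm V * C ^ m" for m
  proof (cases m)
    case (Suc j)
    have "norm (c m) \<le> norm V * C ^ j"
      using norm_funpow_bound[of T C j V] C by (simp add: c_def Suc)
    also have "\<dots> \<le> norm V * C ^ m"
      using C(2) by (intro mult_left_mono power_increasing) (auto simp: Suc)
    finally show ?thesis .
  qed (simp add: c_def)
  have cb': "norm (c (Suc m)) \<le> (norm V * C) * C ^ m" for m
    using cb[of "Suc m"] by (simp add: mult_ac)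
  have W: "W = (\<lambda>x. \<Sum>m. (x ^ m / fact m) *\<^sub>R c m)"
  proof
    fix x
    show "W x = (\<Sum>m. (x ^ m / fact m) *\<^sub>R c m)"
      by (subst suminf_split_initial_segment[OF summable_exponential_series[OF cb], of x 2])
        (simp add: W_def c_def numeral_2_eq_2)
  qed
  have TW: "T (W x) = (\<Sum>m. (x ^ m / fact m) *\<^sub>R T (c m))"
    unfolding W by (subst bounded_linear.suminf[OF bl summable_exponential_series[OF cb]])
      (simp add: linear_scale[OF T])
  have sT: "summable (\<lambda>m. (x ^ m / fact m) *\<^sub>R T (c m))"
    using bounded_linear.summable[OF bl summable_exponential_series[OF cb, of x]]
    by (simp add: linear_scale[OF T])
  \<comment> \<open>The two coefficient sequences agree from index 1 on and differ by V at index
    0.\<close>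
  have "(\<Sum>m. (x ^ m / fact m) *\<^sub>R c (Suc m)) - T (W x)
     = (\<Sum>m. (x ^ m / fact m) *\<^sub>R c (Suc m) - (x ^ m / fact m) *\<^sub>R T (c m))"
    unfolding TW by (rule suminf_diff[OF summable_exponential_series[OF cb'] sT])
  also have "\<dots> = (\<Sum>m\<in>{0::nat}. (x ^ m / fact m) *\<^sub>R c (Suc m) - (x ^ m / fact m) *\<^sub>R T (c m))"
  proof (rule suminf_finite)
    fix m :: nat assume "m \<notin> {0}"
    then obtain j where "m = Suc j" by (cases m) auto
    then show "(x ^ m / fact m) *\<^sub>R c (Suc m) - (x ^ m / fact m) *\<^sub>R T (c m) = 0"
      by (simp add: c_def)
  qed simp
  also have "\<dots> = V" using linear_0[OF T] by (simp add: c_def)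
  finally have "(\<Sum>m. (x ^ m / fact m) *\<^sub>R c (Suc m)) = V + T (W x)" by (simp add: algebra_simps)
  then show ?thesis
    using has_vector_derivative_exponential_series[OF cb, of x] by (simp add: W)
qed

text \<open>The derivatives of t / D and of t D' / D; the products D geo_m and D geo_k rotate into each
  other, which is what makes t P^perp a solution.\<close>
definition geo_m :: "'n::finite mat \<Rightarrow> real \<Rightarrow> real" where
  "geo_m H t = (geo_D H t - t * geo_D' H t) / (geo_D H t)\<^sup>2"

definition geo_k :: "'n::finite mat \<Rightarrow> real \<Rightarrow> real" where
  "geo_k H t = (geo_D' H t * geo_D H t + t * (real CARD('n) / 8 * trace (H ** H)) * geo_D H t
      - t * (geo_D' H t)\<^sup>2) / (geo_D H t)\<^sup>2"

lemma geo_scalar_derivatives: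
  fixes H :: "real^'n::finite^'n"
  assumes D: "0 < geo_D H t"
  shows "((\<lambda>t. t / geo_D H t) has_real_derivative geo_m H t) (at t)"
    and "((\<lambda>t. t * geo_D' H t / geo_D H t) has_real_derivative geo_k H t) (at t)"
    and "(geo_m H has_real_derivative (- geo_k H t - geo_D' H t * geo_m H t) / geo_D H t) (at t)"
    and "(geo_k H has_real_derivative
       (real CARD('n) / 4 * trace (tf H ** tf H) * geo_m H t - geo_D' H t * geo_k H t) / geo_D H t) (at t)"
proof -
  define q where "q = real CARD('n) / 8 * trace (H ** H)"
  note [derivative_intros] = has_real_derivative_geo_D has_real_derivative_geo_D'[of H, folded q_def]
  have k: "geo_k H = (\<lambda>t. (geo_D' H t * geo_D H t + t * q * geo_D H t - t * (geo_D' H t)\<^sup>2) / (geo_D H t)\<^sup>2)"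
    and m: "geo_m H = (\<lambda>t. (geo_D H t - t * geo_D' H t) / (geo_D H t)\<^sup>2)"
    by (auto simp: geo_k_def geo_m_def q_def)
  have disc: "real CARD('n) / 4 * trace (tf H ** tf H) = 2 * geo_D H t * q - (geo_D' H t)\<^sup>2"
    unfolding q_def by (rule geo_D_discriminant[symmetric])
  show "((\<lambda>t. t / geo_D H t) has_real_derivative geo_m H t) (at t)"
    using D by (auto intro!: derivative_eq_intros simp: m power2_eq_square)
  show "((\<lambda>t. t * geo_D' H t / geo_D H t) has_real_derivative geo_k H t) (at t)"
    using D by (auto intro!: derivative_eq_intros simp: k power2_eq_square algebra_simps)
  show "(geo_m H has_real_derivative (- geo_k H t - geo_D' H t * geo_m H t) / geo_D H t) (at t)"
    unfolding m k using D
    by (auto intro!: derivative_eq_intros) (simp add: field_simps power2_eq_square power4_eq_xxxx)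
  show "(geo_k H has_real_derivative
       (real CARD('n) / 4 * trace (tf H ** tf H) * geo_m H t - geo_D' H t * geo_k H t) / geo_D H t) (at t)"
    unfolding disc unfolding m k using D
    by (auto intro!: derivative_eq_intros) (simp add: field_simps power2_eq_square power4_eq_xxxx)
qed

text \<open>Id, A and V are mutually orthogonal for tr(X Y), and the first argument lies in the span
  of Id and A. Hence this span and the line of V are both preserved, and the equation for z
  decouples from those for x and y.\<close>

lemma lin_rhs_plane:
  fixes A V :: "real^'n::finite^'n"
  assumes "trace A = 0" "trace V = 0" "trace (A ** V) = 0"
  shows "lin_rhs (p *\<^sub>R mat 1 + q *\<^sub>R A) (x *\<^sub>R mat 1 + y *\<^sub>R A + z *\<^sub>R V)
    = (1/2 * q * y * trace (A ** A) - real CARD('n) / 2 * p * x) *\<^sub>R mat 1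
      + (- (real CARD('n) / 2 * (x * q + p * y))) *\<^sub>R A + (- (real CARD('n) / 2 * p * z)) *\<^sub>R V"
proof -
  have 1: "trace ((p *\<^sub>R mat 1 + q *\<^sub>R A) ** (x *\<^sub>R mat 1 + y *\<^sub>R A + z *\<^sub>R V))
     = real CARD('n) * p * x + q * y * trace (A ** A)"
    and 2: "trace (x *\<^sub>R mat 1 + y *\<^sub>R A + z *\<^sub>R V) = real CARD('n) * x"
    and 3: "trace (p *\<^sub>R mat 1 + q *\<^sub>R A) = real CARD('n) * p"
    using assms by (simp_all add: matrix_mult_algebra trace_algebra trace_I)
  show ?thesis unfolding lin_rhs_def 1 2 3
    by (simp add: vec_eq_iff field_simps)
qed

text \<open>The Christoffel symbol is algebraic in the values at a point, so geodesics and their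
  variations can be treated pointwise. \<open>I_dom\<close> says D > 0, keeping a(t) defined. The
  series index starts at 0, whence the exponent m + 1 and the factorial of m + 2.\<close>

theorem theorem4p7:
  fixes g0 h k l :: "real^'n::finite^'n"
    and \<alpha> :: "real \<times> real \<Rightarrow> real^'n^'n"
    and I :: "real set" and \<epsilon> :: real
  defines "H \<equiv> matrix_inv g0 ** h"
    and "K \<equiv> matrix_inv g0 ** k"
    and "L \<equiv> matrix_inv g0 ** l"
  defines "Lh \<equiv> - (K ** H) + L + matrix_inv g0 ** Christ g0 k h"
    and "g \<equiv> geo g0 h"
    and "J \<equiv> (\<lambda>t. vector_derivative (\<lambda>s. \<alpha> (t, s)) (at 0))"
  assumes g0: "posdef_sym g0"
    and hkl: "sym_mat h" "sym_mat k" "sym_mat l"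
    and h_nz: "h \<noteq> 0"
    and I: "open I" "is_interval I" "0 \<in> I"
    and I_dom: "\<forall>t\<in>I. 0 < (1 + t/4 * trace H)\<^sup>2 + real CARD('n) / 16 * trace (tf H ** tf H) * t\<^sup>2"
    and eps: "0 < \<epsilon>"
    and smooth: "C2_on \<alpha> (I \<times> {-\<epsilon><..<\<epsilon>})"
    and geod: "\<forall>s\<in>{-\<epsilon><..<\<epsilon>}. is_geodesic (\<lambda>t. \<alpha> (t, s)) I"
    and base: "\<forall>t\<in>I. \<alpha> (t, 0) = g t"
    and J0: "J 0 = k"
    and DJ0: "vector_derivative J (at 0) - Christ g0 h (J 0) = l"
  shows "\<forall>t\<in>I. J t =
      (trace (H ** Lh) / trace (H ** H) * t) *\<^sub>R vector_derivative g (at t)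
    + ((trace Lh * trace (H ** H) - trace (Lh ** H) * trace H) / trace (H ** H) * t)
        *\<^sub>R (g t ** Pperp H t)
    + geo_b H t *\<^sub>R (g t ** (- (trace (tf H ** tf Lh) / trace (tf H ** tf H)) *\<^sub>R tf H + tf Lh))
    + g t ** (\<Sum>m. (1 / fact (m + 2)) *\<^sub>R
                 (((\<lambda>X. - ad (geo_b H t *\<^sub>R H) X) ^^ (m + 1)) (geo_b H t *\<^sub>R Lh)))
    + k ** matrix_inv g0 ** g t"
proof

  \<comment> \<open>Constants of the initial data\<close>
  define n where "n = real CARD('n)"
  define T where "T = trace H"
  define S where "S = trace (H ** H)"
  define \<tau> where "\<tau> = trace (tf H ** tf H)"
  define u where "u = trace (tf H ** tf Lh)"
  have n: "0 < n" by (simp add: n_def)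
  note ginv = matrix_inv_left_right[OF posdef_sym_invertible[OF g0]]
  have H_nz: "H \<noteq> 0"
    using h_nz ginv by (metis H_def matrix_mul_assoc matrix_mul_lid bounded_bilinear.zero_right[OF bounded_bilinear_matrix_mult])
  have S: "0 < S"
    using trace_square_selfadjoint[OF g0 hkl(1)] H_nz unfolding S_def H_def by linarith
  \<comment> \<open>H_0 is again \<open>matrix_inv g0\<close> times a symmetric matrix, so \<tau> is
    nonnegative and vanishes only for H_0 = 0.\<close>
  have tfH: "tf H = matrix_inv g0 ** (h - (T / n) *\<^sub>R g0)"
    by (simp add: tf_def H_def T_def n_def matrix_mult_algebra ginv)
  have "sym_mat (h - (T / n) *\<^sub>R g0)"
    using hkl(1) g0 unfolding posdef_sym_def sym_mat_def
    by (simp add: vec_eq_iff transpose_def)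
  note \<tau>_sq = trace_square_selfadjoint[OF g0 this, folded tfH \<tau>_def]
  have \<tau>S: "\<tau> = S - T\<^sup>2 / n" unfolding \<tau>_def S_def T_def n_def by (rule trace_tf_square)
  have H_eq: "H = tf H + (T / n) *\<^sub>R mat 1" and Lh_eq: "Lh = tf Lh + (trace Lh / n) *\<^sub>R mat 1"
    by (simp_all add: tf_def T_def n_def)
  have trHL: "trace (H ** Lh) = u + T * trace Lh / n"
    by (subst H_eq, subst (1) Lh_eq) (simp add: matrix_mult_algebra trace_algebra trace_I u_def n_def)
  have trLH: "trace (Lh ** H) = trace (H ** Lh)" by (rule trace_mul_sym)

  \<comment> \<open>(t P)' and (t P^perp)' start at H and P^perp(0). Pairing Lh with H, to which
    P^perp(0) and V are orthogonal, gives c1; since P^perp(0) has trace 1, the trace gives c1 T + c2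
    = tr Lh. The H_0-coefficient of c2 P^perp is -c3 D'/D.\<close>
  define c1 where "c1 = trace (H ** Lh) / S"
  define c2 where "c2 = (trace Lh * S - trace (Lh ** H) * T) / S"
  define c3 where "c3 = 2 * c2 / (n * \<tau>)"
  have c1T: "c1 * T + c2 = trace Lh" using S by (simp add: c1_def c2_def trLH field_simps)
  have u0: "u = 0" if "\<tau> = 0" using \<tau>_sq(2)[OF that] by (simp add: u_def matrix_mult_algebra trace_algebra)
  \<comment> \<open>For tf H = 0 the description of Pperp is unsatisfiable, but its coefficient vanishes.\<close>
  have c20: "c2 = 0" if "\<tau> = 0"
  proof -
    have "S = T\<^sup>2 / n" using that \<tau>S by simp
    then have "trace Lh * S - trace (Lh ** H) * T = 0"
      using u0[OF that] by (simp add: trLH trHL power2_eq_square)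
    then show ?thesis by (simp add: c2_def)
  qed
  \<comment> \<open>Both sides vanish for \<tau> = 0, so the differential equation for
    \<open>Qe\<close> can be checked without a case split.\<close>
  have c3\<tau>: "\<tau> * c3 = 2 * c2 / n" using c20 by (cases "\<tau> = 0") (auto simp: c3_def)
  \<comment> \<open>The component of Lh orthogonal to Id and H_0. For \<tau> = 0 the quotient is 0
    by convention, and it multiplies tf H = 0.\<close>
  define V where "V = tf Lh - (u / \<tau>) *\<^sub>R tf H"
  have V: "trace V = 0" "trace (tf H ** V) = 0"
    using u0 by (auto simp: V_def trace_algebra matrix_mult_algebra u_def[symmetric] \<tau>_def[symmetric])

  \<comment> \<open>Linearised data of the given variation\<close>
  let ?D = "geo_D H" and ?d = "geo_D' H"
  have D: "0 < ?D t" if "t \<in> I" for t using I_dom that by (simp add: geo_D_def)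
  have nn: "0 \<le> trace (tf H ** tf H)" using \<tau>_sq(1) by (simp add: \<tau>_def)
  define P where "P = Pgeo H"
  have P_eq: "P t = (2 * ?d t / (n * ?D t)) *\<^sub>R mat 1 + (1 / ?D t) *\<^sub>R tf H" if "t \<in> I" for t
    unfolding P_def n_def by (rule Pgeo_eq[OF D[OF that]])
  have g': "(g has_vector_derivative g t ** P t) (at t)" if "t \<in> I" for t
    unfolding g_def P_def by (rule has_vector_derivative_geo[of g0 h t, folded H_def, OF nn D[OF that]])
  have P0: "P 0 = H"
  proof -
    have "P 0 = (T / n) *\<^sub>R mat 1 + tf H"
      using P_eq[OF I(3)] by (simp add: geo_D_def geo_D'_def T_def)
    then show ?thesis using H_eq by (metis add.commute)
  qed
  have "((\<lambda>t. \<alpha> (t, 0)) has_vector_derivative \<alpha> (t, 0) ** P t) (at t)" if "t \<in> I" for t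
    using has_vector_derivative_transform_within_open[OF g'[OF that] I(1) that, of "\<lambda>t. \<alpha> (t, 0)"] base that
    by simp
  from geodesic_variation[OF I(1) eps smooth _ this] geod
  obtain Jv Q where Jv: "\<And>t. t \<in> I \<Longrightarrow> ((\<lambda>s. \<alpha> (t, s)) has_vector_derivative Jv t) (at 0)"
    and Jv': "\<And>t. t \<in> I \<Longrightarrow> (Jv has_vector_derivative Jv t ** P t + \<alpha> (t, 0) ** Q t) (at t)"
    and Q': "\<And>t. t \<in> I \<Longrightarrow> (Q has_vector_derivative lin_rhs (P t) (Q t)) (at t)"
    by blast
  have J_Jv: "J t = Jv t" if "t \<in> I" for t
    unfolding J_def by (rule vector_derivative_at[OF Jv[OF that]])
  have g0_eq: "g 0 = g0" by (simp add: g_def geo_0)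
  have Jv0: "Jv 0 = k" using J_Jv[OF I(3)] J0 by simp
  \<comment> \<open>The prescribed covariant derivative makes J'(0) equal to l plus the Christoffel
    term, while the linearised system makes it k H + g0 Q(0).\<close>
  have Q0: "Q 0 = Lh"
  proof -
    have "(J has_vector_derivative Jv 0 ** P 0 + \<alpha> (0, 0) ** Q 0) (at 0)"
      by (rule has_vector_derivative_transform_within_open[OF Jv'[OF I(3)] I(1,3)]) (simp add: J_Jv)
    then have "vector_derivative J (at 0) = k ** H + g0 ** Q 0"
      using base I(3) by (simp add: vector_derivative_at Jv0 P0 g0_eq)
    then have "g0 ** Q 0 = l + Christ g0 k h - k ** H"
      using DJ0 J0 Christ_commute[of g0 h k] by (simp add: algebra_simps)
    then have "matrix_inv g0 ** (g0 ** Q 0) = matrix_inv g0 ** (l + Christ g0 k h - k ** H)" by simp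
    then show ?thesis
      by (simp add: matrix_mul_assoc ginv) (simp add: matrix_mult_algebra Lh_def K_def L_def matrix_mul_assoc)
  qed

  \<comment> \<open>Solution of the equation for Q\<close>
  have contP: "continuous_on I P"
  proof -
    have "continuous_on I ?D" "continuous_on I ?d"
      using has_real_derivative_geo_D[of H] has_real_derivative_geo_D'[of H]
      by (auto intro!: continuous_at_imp_continuous_on DERIV_isCont)
    then have "continuous_on I (\<lambda>t. (2 * ?d t / (n * ?D t)) *\<^sub>R mat 1 + (1 / ?D t) *\<^sub>R tf H)"
      using n D by (intro continuous_intros) force+
    then show ?thesis by (rule continuous_on_eq) (simp add: P_eq)
  qed

  \<comment> \<open>\<open>x\<close> and \<open>y\<close> are the coefficients of c1 (t P)' + c2 (t
    P^perp)' along Id and H_0.\<close>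
  define x where "x t = c1 * (2 / n) * geo_k H t + c2 / n * geo_m H t" for t
  define y where "y t = c1 * geo_m H t - c3 * geo_k H t" for t
  define Qe where "Qe t = x t *\<^sub>R mat 1 + y t *\<^sub>R tf H + (1 / ?D t) *\<^sub>R V" for t
  have Qe': "(Qe has_vector_derivative lin_rhs (P t) (Qe t)) (at t)" if t: "t \<in> I" for t
  proof -
    note der = geo_scalar_derivatives[OF D[OF t], folded \<tau>_def n_def]
    define m k where "m = geo_m H t" and "k = geo_k H t"
    have x': "(x has_real_derivative (\<tau> * y t / 2 - ?d t * x t) / ?D t) (at t)"
    proof -
      have "(x has_real_derivative c1 * (2 / n) * ((n / 4 * \<tau> * m - ?d t * k) / ?D t)
          + c2 / n * ((- k - ?d t * m) / ?D t)) (at t)"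
        unfolding x_def[abs_def] m_def k_def by (intro DERIV_add DERIV_cmult der)
      moreover have \<tau>y: "\<tau> * y t = c1 * \<tau> * m - 2 * c2 / n * k"
        unfolding c3\<tau>[symmetric] by (simp add: y_def m_def k_def algebra_simps)
      ultimately show ?thesis
        unfolding \<tau>y using n D[OF t] by (elim DERIV_cong) (simp add: x_def m_def[symmetric] k_def[symmetric] field_simps)
    qed
    have y': "(y has_real_derivative - ((n * x t / 2 + ?d t * y t) / ?D t)) (at t)"
    proof -
      have "(y has_real_derivative c1 * ((- k - ?d t * m) / ?D t)
          - c3 * ((n / 4 * \<tau> * m - ?d t * k) / ?D t)) (at t)"
        unfolding y_def[abs_def] m_def k_def by (intro DERIV_diff DERIV_cmult der)
      moreover have "c3 * (n / 4 * \<tau> * m) = c2 * m / 2" using c3\<tau> n by (simp add: field_simps)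
      then have "c3 * ((n / 4 * \<tau> * m - ?d t * k) / ?D t) = (c2 * m / 2 - c3 * ?d t * k) / ?D t"
        by (simp add: right_diff_distrib)
      ultimately show ?thesis
        using n D[OF t] by (elim DERIV_cong) (auto simp: x_def y_def m_def[symmetric] k_def[symmetric] field_simps)
    qed
    have z': "((\<lambda>t. 1 / ?D t) has_real_derivative - (?d t / ?D t * (1 / ?D t))) (at t)"
      using D[OF t] by (auto intro!: derivative_eq_intros has_real_derivative_geo_D)
    have "(Qe has_vector_derivative ((\<tau> * y t / 2 - ?d t * x t) / ?D t) *\<^sub>R mat 1
       + (- ((n * x t / 2 + ?d t * y t) / ?D t)) *\<^sub>R tf H + (- (?d t / ?D t * (1 / ?D t))) *\<^sub>R V) (at t)"
      unfolding Qe_def[abs_def]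
      using has_vector_derivative_add[OF has_vector_derivative_add[OF
          has_vector_derivative_scaleR[OF x' has_vector_derivative_const[of "mat 1"]]
          has_vector_derivative_scaleR[OF y' has_vector_derivative_const[of "tf H"]]]
          has_vector_derivative_scaleR[OF z' has_vector_derivative_const[of V]]] by simp
    moreover have "lin_rhs (P t) (Qe t) = ((\<tau> * y t / 2 - ?d t * x t) / ?D t) *\<^sub>R mat 1
       + (- ((n * x t / 2 + ?d t * y t) / ?D t)) *\<^sub>R tf H + (- (?d t / ?D t * (1 / ?D t))) *\<^sub>R V"
      unfolding P_eq[OF t] Qe_def lin_rhs_plane[OF trace_tf V] \<tau>_def[symmetric] n_def[symmetric]
      using n D[OF t] by (intro arg_cong2[where f = "(+)"] arg_cong2[where f = scaleR]) (auto simp: field_simps)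
    ultimately show ?thesis by simp
  qed
  have D0: "?D 0 = 1" "?d 0 = T / 2" by (simp_all add: geo_D_def geo_D'_def T_def)
  have Qe0: "Qe 0 = Lh"
  proof -
    have x0: "x 0 = trace Lh / n" and y0: "y 0 = c1 - c3 * (T / 2)"
      using n c1T by (simp_all add: x_def y_def geo_m_def geo_k_def D0 field_simps)
    \<comment> \<open>For H_0 = 0 the coefficients themselves need not match; only the product with
      \<open>tf H\<close> is claimed.\<close>
    have "(y 0 - u / \<tau>) *\<^sub>R tf H = 0"
    proof (cases "\<tau> = 0")
      case True
      then show ?thesis using \<tau>_sq(2) by simp
    next
      case False
      have "\<tau> * y 0 = c1 * \<tau> - c2 * T / n"
        using c3\<tau> unfolding y0 by (simp add: algebra_simps)
      also have "c2 = trace Lh - c1 * T" using c1T by simp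
      also have "c1 * \<tau> - (trace Lh - c1 * T) * T / n = c1 * S - T * trace Lh / n"
        using n by (simp add: \<tau>S field_simps power2_eq_square)
      also have "\<dots> = u" using S by (simp add: c1_def trHL)
      finally show ?thesis using False by (simp add: field_simps)
    qed
    then have "Qe 0 = x 0 *\<^sub>R mat 1 + tf Lh"
      by (simp add: Qe_def D0 V_def algebra_simps)
    then show ?thesis using Lh_eq x0 by (simp add: add.commute)
  qed
  have Q_eq: "Q t = Qe t" if t: "t \<in> I" for t
  proof -
    obtain C where C: "\<And>A B. norm (lin_rhs A B :: real^'n^'n) \<le> norm A * norm B * C"
      using bounded_bilinear.bounded[OF bounded_bilinear_lin_rhs] by blast
    have "Q t - Qe t = 0"
    proof (rule linear_ode_unique_zero[OF I(2,3) t, where c = "\<lambda>t. norm (P t) * C"])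
      show "((\<lambda>t. Q t - Qe t) has_vector_derivative lin_rhs (P t) (Q t - Qe t)) (at t)" if "t \<in> I" for t
        using has_vector_derivative_diff[OF Q'[OF that] Qe'[OF that]]
        by (simp add: bounded_bilinear.diff_right[OF bounded_bilinear_lin_rhs])
      show "norm (lin_rhs (P t) (Q t - Qe t)) \<le> norm (P t) * C * norm (Q t - Qe t)" for t
        using C[of "P t" "Q t - Qe t"] by (simp add: mult_ac)
      show "continuous_on I (\<lambda>t. norm (P t) * C)" by (intro continuous_intros contP)
    qed (simp add: Q0 Qe0)
    then show ?thesis by simp
  qed

  \<comment> \<open>Solution of the equation for J\<close>
  define ad' where "ad' = (\<lambda>X. - ad H X)"
  have lin_ad: "linear ad'"
    unfolding linear_iff ad'_def ad_def by (simp add: matrix_mult_algebra algebra_simps)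
  define W where "W = (\<lambda>x. x *\<^sub>R V + (\<Sum>m. (x ^ (m + 2) / fact (m + 2)) *\<^sub>R (ad' ^^ (m + 1)) V))"
  have W': "(W has_vector_derivative V + ad' (W x)) (at x)" for x
    unfolding W_def by (rule has_vector_derivative_exp_minus_one_series[OF lin_ad])
  have W0: "W 0 = 0" by (simp add: W_def)
  \<comment> \<open>The planar part of \<open>Qe\<close> is integrated in closed form; b is the
    natural time of the transverse part because b' = 1/D.\<close>
  define Y where "Y t = (c1 * (2 / n) * (t * ?d t / ?D t) + c2 / n * (t / ?D t)) *\<^sub>R mat 1
     + (c1 * (t / ?D t) - c3 * (t * ?d t / ?D t)) *\<^sub>R tf H + W (geo_b H t)" for t
  have Y': "(Y has_vector_derivative Qe t + (1 / ?D t) *\<^sub>R ad' (W (geo_b H t))) (at t)" if t: "t \<in> I" for t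
  proof -
    note der = geo_scalar_derivatives(1,2)[OF D[OF t]]
    have x': "((\<lambda>t. c1 * (2 / n) * (t * ?d t / ?D t) + c2 / n * (t / ?D t)) has_real_derivative x t) (at t)"
      unfolding x_def by (intro DERIV_add DERIV_cmult der)
    have y': "((\<lambda>t. c1 * (t / ?D t) - c3 * (t * ?d t / ?D t)) has_real_derivative y t) (at t)"
      unfolding y_def by (intro DERIV_diff DERIV_cmult der)
    have w': "((\<lambda>t. W (geo_b H t)) has_vector_derivative (1 / ?D t) *\<^sub>R (V + ad' (W (geo_b H t)))) (at t)"
      using vector_diff_chain_at[OF has_real_derivative_geo_b[OF nn D[OF t], unfolded has_real_derivative_iff_has_vector_derivative] W']
      by (simp add: o_def)
    show ?thesis
      unfolding Y_def[abs_def]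
      using has_vector_derivative_add[OF has_vector_derivative_add[OF
          has_vector_derivative_scaleR[OF x' has_vector_derivative_const[of "mat 1"]]
          has_vector_derivative_scaleR[OF y' has_vector_derivative_const[of "tf H"]]] w']
      by (simp add: Qe_def scaleR_add_right add.assoc)
  qed
  \<comment> \<open>Id and H_0 commute with P, so only \<open>W\<close> contributes; ad H equals ad
    H_0 because Id is central.\<close>
  have ad_PY: "P t ** Y t - Y t ** P t = - (1 / ?D t) *\<^sub>R ad' (W (geo_b H t))" if t: "t \<in> I" for t
  proof -
    have adW: "ad' (W (geo_b H t)) = W (geo_b H t) ** tf H - tf H ** W (geo_b H t)"
      unfolding ad'_def ad_def by (subst (1 2) H_eq) (simp add: matrix_mult_algebra)
    show ?thesis
      unfolding adW P_eq[OF t] Y_def by (simp add: matrix_mult_algebra algebra_simps)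
  qed
  \<comment> \<open>The second summand solves J' = J P and carries the initial value k; the first
    one starts at 0.\<close>
  define Z where "Z t = g t ** Y t + k ** matrix_inv g0 ** g t" for t
  have Z': "(Z has_vector_derivative Z t ** P t + g t ** Q t) (at t)" if t: "t \<in> I" for t
  proof -
    have "(Z has_vector_derivative (g t ** (Qe t + (1 / ?D t) *\<^sub>R ad' (W (geo_b H t))) + g t ** P t ** Y t)
       + k ** matrix_inv g0 ** (g t ** P t)) (at t)"
      unfolding Z_def[abs_def]
      by (intro has_vector_derivative_add has_vector_derivative_matrix_mult[OF g'[OF t] Y'[OF t]]
         bounded_linear.has_vector_derivative[OF bounded_bilinear.bounded_linear_right[OF bounded_bilinear_matrix_mult] g'[OF t]])
    moreover have "P t ** Y t = Y t ** P t + - (1 / ?D t) *\<^sub>R ad' (W (geo_b H t))"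
      using ad_PY[OF t] by (simp add: algebra_simps)
    ultimately show ?thesis
      by (simp add: Z_def Q_eq[OF t] matrix_mul_assoc[symmetric]) (simp add: matrix_mult_algebra matrix_mul_assoc algebra_simps)
  qed
  have J_eq: "J t = Z t" if t: "t \<in> I" for t
  proof -
    obtain C where C: "\<And>A B :: real^'n^'n. norm (A ** B :: real^'n^'n) \<le> norm A * norm B * C"
      using bounded_bilinear.bounded[OF bounded_bilinear_matrix_mult] by blast
    have "Jv t - Z t = 0"
    proof (rule linear_ode_unique_zero[OF I(2,3) t, where c = "\<lambda>t. norm (P t) * C"])
      show "((\<lambda>t. Jv t - Z t) has_vector_derivative (Jv t - Z t) ** P t) (at t)" if "t \<in> I" for t
        using has_vector_derivative_diff[OF Jv'[OF that] Z'[OF that]] base that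
        by (simp add: matrix_mult_algebra)
      show "norm ((Jv t - Z t) ** P t) \<le> norm (P t) * C * norm (Jv t - Z t)" for t
        using C[of "Jv t - Z t" "P t"] by (simp add: mult_ac)
      show "continuous_on I (\<lambda>t. norm (P t) * C)" by (intro continuous_intros contP)
      have "geo_b H 0 = 0" by (simp add: geo_b_def Let_def)
      then show "Jv 0 - Z 0 = 0"
        by (simp add: Z_def Y_def W0 matrix_mult_algebra Jv0 g0_eq matrix_mul_assoc[symmetric] ginv)
    qed
    then show ?thesis using J_Jv[OF t] by simp
  qed

  \<comment> \<open>Comparison with the stated formula\<close>
  fix t assume t: "t \<in> I"
  define b where "b = geo_b H t"
  have pow: "((\<lambda>X. - ad (b *\<^sub>R H) X) ^^ m) X = b ^ m *\<^sub>R (ad' ^^ m) X" for m X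
  proof (induction m)
    case (Suc m)
    have "- ad (b *\<^sub>R H) (b ^ m *\<^sub>R Z) = b ^ Suc m *\<^sub>R ad' Z" for Z
      by (simp add: ad'_def ad_def matrix_mult_algebra algebra_simps)
    then show ?case using Suc by simp
  qed simp
  \<comment> \<open>Lh - V lies in the plane, which ad H annihilates. Every term of the series
    applies \<open>ad'\<close> at least once, so Lh may be replaced by V there.\<close>
  have "ad' Lh = ad' V"
  proof -
    have "Lh - V = (u / \<tau>) *\<^sub>R tf H + (trace Lh / n) *\<^sub>R mat 1"
      using Lh_eq by (simp add: V_def algebra_simps)
    moreover have "ad' (tf H) = 0" "ad' (mat 1) = 0"
      unfolding ad'_def ad_def tf_def by (simp_all add: matrix_mult_algebra)
    ultimately have "ad' (Lh - V) = 0"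
      by (simp add: linear_add[OF lin_ad] linear_scale[OF lin_ad])
    then show ?thesis by (simp add: linear_diff[OF lin_ad])
  qed
  then have ad_pow: "(ad' ^^ (m + 1)) Lh = (ad' ^^ (m + 1)) V" for m
    by (simp add: funpow_Suc_right del: funpow.simps)
  have "(1 / fact (m + 2)) *\<^sub>R ((\<lambda>X. - ad (b *\<^sub>R H) X) ^^ (m + 1)) (b *\<^sub>R Lh)
     = (b ^ (m + 2) / fact (m + 2)) *\<^sub>R (ad' ^^ (m + 1)) V" for m
  proof -
    have "linear (ad' ^^ j)" for j
      by (induction j) (auto simp: linear_iff linear_add[OF lin_ad] linear_scale[OF lin_ad])
    then have "(ad' ^^ (m + 1)) (b *\<^sub>R Lh) = b *\<^sub>R (ad' ^^ (m + 1)) V"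
      unfolding ad_pow[symmetric] by (rule linear_scale)
    then show ?thesis unfolding pow by simp
  qed
  \<comment> \<open>The subtracted linear term b V of \<open>W\<close> is the separate third summand
    of the formula.\<close>
  then have series: "(\<Sum>m. (1 / fact (m + 2)) *\<^sub>R ((\<lambda>X. - ad (b *\<^sub>R H) X) ^^ (m + 1)) (b *\<^sub>R Lh)) = W b - b *\<^sub>R V"
    by (simp add: W_def)
  have plane: "Y t = (c1 * t) *\<^sub>R P t + (c2 * t) *\<^sub>R Pperp H t + W b"
  proof -
    have "(c2 * t) *\<^sub>R Pperp H t = (c2 / n * (t / ?D t)) *\<^sub>R mat 1 - (c3 * (t * ?d t / ?D t)) *\<^sub>R tf H"
    proof (cases "\<tau> = 0")
      case True
      then show ?thesis using c20 by (simp add: c3_def)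
    next
      case False
      then show ?thesis
        unfolding Pperp_eq[OF D[OF t] False[unfolded \<tau>_def]] n_def[symmetric] \<tau>_def[symmetric]
        by (simp add: c3_def scaleR_diff_right mult_ac)
    qed
    then show ?thesis unfolding Y_def P_eq[OF t] b_def
      by (simp add: algebra_simps)
  qed
  show "J t =
      (trace (H ** Lh) / trace (H ** H) * t) *\<^sub>R vector_derivative g (at t)
    + ((trace Lh * trace (H ** H) - trace (Lh ** H) * trace H) / trace (H ** H) * t)
        *\<^sub>R (g t ** Pperp H t)
    + geo_b H t *\<^sub>R (g t ** (- (trace (tf H ** tf Lh) / trace (tf H ** tf H)) *\<^sub>R tf H + tf Lh))
    + g t ** (\<Sum>m. (1 / fact (m + 2)) *\<^sub>R
                 (((\<lambda>X. - ad (geo_b H t *\<^sub>R H) X) ^^ (m + 1)) (geo_b H t *\<^sub>R Lh)))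
    + k ** matrix_inv g0 ** g t"
    unfolding b_def[symmetric] series S_def[symmetric] T_def[symmetric] u_def[symmetric] \<tau>_def[symmetric]
      c1_def[symmetric] c2_def[symmetric] vector_derivative_at[OF g'[OF t]] J_eq[OF t] Z_def plane
    by (simp add: matrix_mult_algebra V_def algebra_simps)
qed

end
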